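(* Let $K\ge1$ be an integer and let $\mu_1,\dots,\mu_K>0$ be fixed. For each $n$ consider the multi-server job queueing system with $n$ servers and $K$ job classes under the First-Come-First-Served (FCFS) policy, with class arrival rates $\lambda_i^{(n)}$, service rates $\mu_i$ and server needs $m_i^{(n)}$, and let $X_i^{(n)}(t)$ be the number of class $i$ jobs in the system (in queue plus in service) at time $t$. Suppose that for each class $i\in\{1,\dots,K\}$ the load $\rho_i^{(n)}=\frac{\lambda_i^{(n)}m_i^{(n)}}{n\mu_i}$ satisfies $\rho_i^{(n)}=\rho_i>0$ for all $n$, and that $\rho=\sum_{i=1}^K\rho_i<1$. Assume that for each $i$, $\lim_{n\to\infty}\frac{1}{\lambda_i^{(n)}}X_i^{(n)}(0)=y_i(0)$ in probability, where $\mathbf y(0)=(y_1(0),\dots,y_K(0))$ is deterministic with $0\le y_i(0)<\frac{1}{\rho\mu_i}$ for all $i$. Let $\mathbf y(t)=(y_1(t),\dots,y_K(t))$, $t\ge0$, be the unique solution of $$\dot y_i(t)=1-\min\left\{\mu_i y_i(t),\frac{1}{\rho_i}\right\},\qquad i\in\{1,\dots,K\},$$ with initial condition $\mathbf y(0)$. If $m_{\max}^{(n)}=\max_{1\le i\le K}m_i^{(n)}$ satisfies $m_{\max}^{(n)}=o(n)$, then for any fixed $T>0$, $$\lim_{n\to\infty}\sup_{0\le t\le T}\sum_{i=1}^K\left|\frac{1}{\lambda_i^{(n)}}X_i^{(n)}(t)-y_i(t)\right|=0\quad\text{in probability.}$$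
   Context: Multi-server job queueing model. There are $n$ identical servers and $K$ job classes. Jobs arrive according to a Poisson process of rate $\lambda^{(n)}>0$; each arrival is independently of class $i$ with probability $p_i^{(n)}$ ($\sum_i p_i^{(n)}=1$), so class $i$ jobs arrive as a Poisson process of rate $\lambda_i^{(n)}=\lambda^{(n)}p_i^{(n)}$. A class $i$ job has server need $m_i^{(n)}$, an integer with $1\le m_i^{(n)}\le n$: it occupies $m_i^{(n)}$ servers simultaneously for its whole service time. Service times are independent, independent of arrivals, and exponentially distributed with rate $\mu_i$ for class $i$. FCFS policy: arriving jobs join a single FCFS queue of infinite capacity. An arriving job enters service immediately if the queue is empty and the number of idle servers is at least its server need; otherwise it waits in the queue. Jobs enter service in arrival order: the head-of-queue job enters service as soon as the number of idle servers is at least its server need, and while it cannot enter service it blocks all jobs behind it. State: the system is described by the continuous-time Markov chain $\mathbf U^{(n)}(t)=(u_1(t),\dots,u_J(t))$, the list of the classes of all jobs in the system (in queue plus in service) at time $t$, in arrival order, with $J\in\{0,1,2,\dots\}$ and $u_j(t)\in\{1,\dots,K\}$. In state $u$, the jobs in service are those in the longest prefix $(u_1,\dots,u_k)$ with $\sum_{j=1}^k m_{u_j}^{(n)}\le n$. Transitions: a class $i$ is appended at the end of the list at rate $\lambda_i^{(n)}$, and each job in service, of class $i$ say, is removed from the list at rate $\mu_i$. $X_i^{(n)}(t)$ is the number of entries of $\mathbf U^{(n)}(t)$ equal to $i$. The initial state may be random. *)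

theory Defs
  imports "HOL-Probability.Probability" "HOL-Library.Landau_Symbols"
begin

section \<open>Continuous-time Markov chains\<close>

text \<open>A rate function \<open>q\<close> gives the rate \<open>q u v \<ge> 0\<close> of jumping from \<open>u\<close> to \<open>v \<noteq> u\<close>;
  diagonal values are ignored.\<close>

definition exit_rate :: "('s \<Rightarrow> 's \<Rightarrow> real) \<Rightarrow> 's \<Rightarrow> real" where
  "exit_rate q u = (\<Sum>\<^sub>\<infinity>v\<in>UNIV - {u}. q u v)"

definition jump_prob :: "('s \<Rightarrow> 's \<Rightarrow> real) \<Rightarrow> 's \<Rightarrow> 's \<Rightarrow> real" where
  "jump_prob q u v = (if v = u then 0 else q u v / exit_rate q u)"

text \<open>Jump chain / holding time definition, for a countable state space without absorbing states:
  \<open>Z k\<close> is the state after the \<open>k\<close>-th jump and \<open>S k\<close> the time spent there, so the \<open>k\<close>-th jump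
  occurs at time \<open>\<Sum>j<k. S j\<close>. Given the jump chain \<open>Z\<close>, the \<open>S k\<close> are independent and
  exponentially distributed with rates \<open>exit_rate q (Z k)\<close>. The initial distribution is
  arbitrary.

  The sample-path clause is required for every outcome and says that each path \<open>t \<mapsto> U t \<omega>\<close> on
  \<open>[0, \<infinity>)\<close> is right-continuous with finitely many jumps in bounded intervals (i.e. cadlag for the
  discrete topology). When the exit rates are bounded the jump times tend to infinity almost
  surely, so there this is only the usual choice of a version with regular paths. Measurability
  of each \<open>U t\<close> with \<open>t \<ge> 0\<close> follows from that of \<open>Z\<close> and \<open>S\<close>.\<close>

definition is_ctmc :: "'w measure \<Rightarrow> ('s \<Rightarrow> 's \<Rightarrow> real) \<Rightarrow> (real \<Rightarrow> 'w \<Rightarrow> 's) \<Rightarrow> bool" where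
  "is_ctmc M q U \<longleftrightarrow>
     prob_space M \<and>
     (\<exists>(Z :: nat \<Rightarrow> 'w \<Rightarrow> 's) (S :: nat \<Rightarrow> 'w \<Rightarrow> real).
        (\<forall>k. Z k \<in> measurable M (count_space UNIV)) \<and>
        (\<forall>k. S k \<in> borel_measurable M) \<and>
        (\<forall>\<omega>\<in>space M.
           (\<forall>k. 0 < S k \<omega>) \<and>
           (\<forall>t\<ge>0. \<exists>k. (\<Sum>j<k. S j \<omega>) \<le> t \<and> t < (\<Sum>j<Suc k. S j \<omega>) \<and> U t \<omega> = Z k \<omega>)) \<and>
        (\<forall>k (z :: nat \<Rightarrow> 's) (s :: nat \<Rightarrow> real). (\<forall>j. 0 \<le> s j) \<longrightarrow>
           measure M {\<omega>\<in>space M. (\<forall>j\<le>k. Z j \<omega> = z j) \<and> (\<forall>j<k. s j < S j \<omega>)} =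
           measure M {\<omega>\<in>space M. Z 0 \<omega> = z 0} *
             (\<Prod>j<k. exp (- exit_rate q (z j) * s j) * jump_prob q (z j) (z (Suc j)))))"


section \<open>The multi-server job system under FCFS\<close>

text \<open>Job classes are the elements of a finite type \<open>'k\<close>, so the number of classes is
  \<open>CARD('k) \<ge> 1\<close>. A state lists the classes of all jobs in the system in arrival order.
  With \<open>n\<close> servers and server needs \<open>m\<close>, the jobs in service form the longest prefix of
  total need at most \<open>n\<close>.\<close>

definition num_in_service :: "nat \<Rightarrow> ('k \<Rightarrow> nat) \<Rightarrow> 'k list \<Rightarrow> nat" where
  "num_in_service n m u = Max {k. k \<le> length u \<and> (\<Sum>j<k. m (u ! j)) \<le> n}"

text \<open>The second sum runs over positions rather than classes: different jobs in service whose
  departures lead to the same list \<open>v\<close> contribute their rates additively.\<close>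

definition fcfs_rate ::
  "nat \<Rightarrow> ('k::finite \<Rightarrow> real) \<Rightarrow> ('k \<Rightarrow> nat) \<Rightarrow> ('k \<Rightarrow> real) \<Rightarrow> 'k list \<Rightarrow> 'k list \<Rightarrow> real" where
  "fcfs_rate n lam m \<mu> u v =
     (\<Sum>i\<in>UNIV. (if v = u @ [i] then lam i else 0)) +
     (\<Sum>j<num_in_service n m u. (if v = take j u @ drop (Suc j) u then \<mu> (u ! j) else 0))"

definition num_jobs :: "(real \<Rightarrow> 'w \<Rightarrow> 'k list) \<Rightarrow> 'k \<Rightarrow> real \<Rightarrow> 'w \<Rightarrow> nat" where
  "num_jobs U i t \<omega> = count_list (U t \<omega>) i"


section \<open>Convergence in probability to a constant\<close>

text \<open>The \<open>n\<close>-th variable lives on its own probability space. Sequences are indexed by the number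
  of servers \<open>n \<ge> 1\<close>; the entry at index \<open>0\<close> is ignored. Since \<open>measure\<close> is \<open>0\<close> on
  non-measurable sets, measurability is part of the definition.\<close>

definition tendsto_in_prob ::
  "(nat \<Rightarrow> 'w measure) \<Rightarrow> (nat \<Rightarrow> 'w \<Rightarrow> real) \<Rightarrow> real \<Rightarrow> bool" where
  "tendsto_in_prob M Y c \<longleftrightarrow>
     (\<forall>n\<ge>1. Y n \<in> borel_measurable (M n)) \<and>
     (\<forall>\<epsilon>>0. (\<lambda>n. measure (M n) {\<omega>\<in>space (M n). \<bar>Y n \<omega> - c\<bar> > \<epsilon>}) \<longlonglongrightarrow> 0)"

end

theory Submission
  imports Defs
begin

text \<open>As long as all jobs fit into the servers, the class counts form independent M/M/\<open>\<infinity>\<close> queues,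
  and the solution of the equation satisfies \<open>\<mu> i * y t i \<le> max (\<mu> i * y 0 i) 1 < 1 / \<rho>\<close>. Hence the
  minimum is never attained by \<open>1 / \<rho> i\<close>, the solution is an explicit exponential, and along it a
  fraction of the servers bounded away from \<open>0\<close> stays idle, so a queue can only form after the
  scaled counts have left a fixed neighbourhood of the solution. Up to that moment the sum of the
  squared scaled deviations, plus \<open>\<Sum>i. \<beta> i * (T - t)\<close> with \<open>\<beta> i = O(1 / lam i)\<close>, is a nonnegative
  supermartingale, and the maximal inequality bounds the probability of leaving the neighbourhood
  before \<open>T\<close>. It tends to \<open>0\<close> because \<open>m n i = o(n)\<close> forces \<open>lam n i \<longlonglongrightarrow> \<infinity>\<close>.\<close>

section \<open>Jump chains with exponential holding times\<close>

text \<open>The obstacle is that \<open>is_ctmc\<close> supplies no generator, no filtration in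
  continuous time and no martingale, only the probabilities of events fixing \<open>Z 0\<close>,
  ..., \<open>Z k\<close> and bounding \<open>S 0\<close>, ..., \<open>S (k - 1)\<close> from below.
  The supermartingale is therefore observed only at jump times, the last one replaced by
  \<open>T\<close>, and everything rests on one conditional expectation per jump. The events above
  form a pi-system, so their probabilities determine the law of \<open>S k\<close> and
  \<open>Z (Suc k)\<close> given the past; the inequality for one jump then comes from the generator
  inequality in the current state, integrated along the sojourn. Observing only jump times has two
  costs. The deviation must be controlled inside a sojourn, which works because each component of
  the fluid solution is monotone in time. And the end of a sojourn is seen only after the jump, with
  one job more or less, which enlarges the threshold by \<open>1 / lam i\<close>. The drift estimate
  can fail once jobs wait, so it may be used only in states where the Lyapunov function is below its
  threshold.\<close>

lemma borel_measurable_nn_integral_countable: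
  fixes h :: "'s::countable \<Rightarrow> 'a \<Rightarrow> ennreal"
  assumes [measurable]: "\<And>v. h v \<in> borel_measurable M"
  shows "(\<lambda>x. \<integral>\<^sup>+v. h v x \<partial>count_space UNIV) \<in> borel_measurable M"
proof (rule sigma_finite_measure.borel_measurable_nn_integral[OF sigma_finite_measure_count_space])
  show "(\<lambda>(x, v). h v x) \<in> borel_measurable (M \<Otimes>\<^sub>M count_space UNIV)"
    unfolding split_beta
    by (rule measurable_compose_countable[where f = "\<lambda>v p. h v (fst p)" and g = snd]) measurable
qed

lemma emeasure_exponential_greaterThan:
  assumes "0 < l" "0 \<le> (a::real)"
  shows "emeasure (density lborel (exponential_density l)) {a<..} = ennreal (exp (- l * a))"
proof -
  interpret E: prob_space "density lborel (exponential_density l)"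
    using assms by (intro prob_space_exponential_density)
  have "distributed (density lborel (exponential_density l)) lborel (\<lambda>x. x) (exponential_density l)"
    by (auto simp: distributed_def distr_id2)
  from E.exponential_distributedD_gt[OF this assms(2,1)]
  show ?thesis
    by (simp add: E.emeasure_eq_measure greaterThan_def mult.commute)
qed

text \<open>The process \<open>U\<close> is absent on purpose: the one-step law and the maximal
  inequality concern only states and sojourn times. \<open>U\<close> joins in
  \<open>jump_path\<close>.\<close>

locale jump_chain = prob_space M
  for M :: "'w measure" +
  fixes q :: "'s::countable \<Rightarrow> 's \<Rightarrow> real"
    and Z :: "nat \<Rightarrow> 'w \<Rightarrow> 's" and S :: "nat \<Rightarrow> 'w \<Rightarrow> real"
  assumes Z_measurable [measurable]: "\<And>k. Z k \<in> measurable M (count_space UNIV)"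
    and S_measurable [measurable]: "\<And>k. S k \<in> borel_measurable M"
    and S_pos: "\<And>k \<omega>. \<omega> \<in> space M \<Longrightarrow> 0 < S k \<omega>"
    and law: "\<And>k z s. (\<forall>j. 0 \<le> s j) \<Longrightarrow>
      prob {\<omega>\<in>space M. (\<forall>j\<le>k. Z j \<omega> = z j) \<and> (\<forall>j<k. s j < S j \<omega>)} =
      prob {\<omega>\<in>space M. Z 0 \<omega> = z 0} *
        (\<Prod>j<k. exp (- exit_rate q (z j) * s j) * jump_prob q (z j) (z (Suc j)))"
    and q_nonneg: "\<And>u v. 0 \<le> q u v"
    and exit_rate_pos: "\<And>u. 0 < exit_rate q u"
begin

section \<open>Information available at a jump\<close>

definition jump_time :: "nat \<Rightarrow> 'w \<Rightarrow> real" where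
  "jump_time k \<omega> = (\<Sum>j<k. S j \<omega>)"

definition cylinder :: "nat \<Rightarrow> (nat \<Rightarrow> 's) \<Rightarrow> (nat \<Rightarrow> real) \<Rightarrow> 'w set" where
  "cylinder k z s = {\<omega>\<in>space M. (\<forall>j\<le>k. Z j \<omega> = z j) \<and> (\<forall>j<k. s j < S j \<omega>)}"

text \<open>The sigma-algebra of \<open>Z 0\<close>, ..., \<open>Z k\<close> and \<open>S 0\<close>,
  ..., \<open>S (k - 1)\<close>: the state just entered is known, its sojourn time is not. It is
  generated by the events whose probabilities \<open>law\<close> states. The empty set is added
  because two cylinders with different states are disjoint, and the generator has to be closed under
  intersection.\<close>

definition past :: "nat \<Rightarrow> 'w measure" where
  "past k = sigma (space M) (insert {} {cylinder k z s | z s. \<forall>j. 0 \<le> s j})"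

lemma jump_prob_nonneg: "0 \<le> jump_prob q u v"
  using q_nonneg[of u v] exit_rate_pos[of u] by (simp add: jump_prob_def)

lemma cylinder_sets: "cylinder k z s \<in> sets M"
  unfolding cylinder_def by measurable

lemma space_past [simp]: "space (past k) = space M"
  unfolding past_def by (rule space_measure_of) (auto simp: cylinder_def)

lemma sets_past: "sets (past k) = sigma_sets (space M) (insert {} {cylinder k z s | z s. \<forall>j. 0 \<le> s j})"
  unfolding past_def by (rule sets_measure_of) (auto simp: cylinder_def)

lemma subalgebra_past: "subalgebra M (past k)"
  unfolding subalgebra_def sets_past
  by (auto simp: cylinder_sets intro!: sets.sigma_sets_subset)

lemma past_sets: "A \<in> sets (past k) \<Longrightarrow> A \<in> sets M"
  using subalgebra_past[of k] by (auto simp: subalgebra_def)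

lemma cylinder_past: "(\<And>j. 0 \<le> s j) \<Longrightarrow> cylinder k z s \<in> sets (past k)"
  unfolding sets_past by (rule sigma_sets.Basic) auto

text \<open>The first \<open>k + 1\<close> states are stored in a list because lists over a
  countable type are countable, whereas functions \<open>nat \<Rightarrow> 's\<close> need not be.
  Unions of cylinders over all initial segments thereby become countable unions.\<close>

lemma cylinder_cover:
  assumes "\<omega> \<in> space M"
  obtains p :: "'s list" where "\<And>j. j \<le> k \<Longrightarrow> p ! j = Z j \<omega>"
proof
  show "map (\<lambda>j. Z j \<omega>) [0..<Suc k] ! j = Z j \<omega>" if "j \<le> k" for j
    using that nth_map[of j "[0..<Suc k]" "\<lambda>j. Z j \<omega>"] nth_upt[of 0 j "Suc k"]
    by (simp del: upt_Suc)
qed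

lemma Z_past [measurable]:
  assumes "j \<le> k"
  shows "Z j \<in> measurable (past k) (count_space UNIV)"
proof (subst measurable_count_space_eq2_countable, intro conjI ballI)
  fix u :: 's
  have "Z j -` {u} \<inter> space M = (\<Union>p\<in>{p::'s list. p ! j = u}. cylinder k (\<lambda>i. p ! i) (\<lambda>_. 0))"
    using assms cylinder_cover[where k = k] S_pos
    by (auto simp: cylinder_def) metis
  also have "\<dots> \<in> sets (past k)"
    by (rule sets.countable_UN') (auto intro!: cylinder_past)
  finally show "Z j -` {u} \<inter> space (past k) \<in> sets (past k)" by simp
qed auto

lemma S_past [measurable]:
  assumes "j < k"
  shows "S j \<in> borel_measurable (past k)"
proof (rule borel_measurableI_greater)
  fix a :: real
  \<comment> \<open>Generators need nonnegative thresholds; since sojourn times are positive, a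
    negative \<open>a\<close> may be replaced by 0, and threshold 0 imposes nothing on the other
    sojourns.\<close>
  let ?s = "\<lambda>i. if i = j then max a 0 else 0"
  have eq: "{\<omega>\<in>space M. a < S j \<omega>} = {\<omega>\<in>space M. max a 0 < S j \<omega>}"
    using S_pos by auto
  also have "\<dots> = (\<Union>p::'s list. cylinder k (\<lambda>i. p ! i) ?s)"
    using assms cylinder_cover[where k = k] S_pos
    by (auto simp: cylinder_def) metis
  also have "\<dots> \<in> sets (past k)"
    by (rule sets.countable_UN') (auto intro!: cylinder_past)
  finally show "{\<omega>\<in>space (past k). a < S j \<omega>} \<in> sets (past k)" by simp
qed

lemma jump_time_past: "j \<le> k \<Longrightarrow> jump_time j \<in> borel_measurable (past k)"
  unfolding jump_time_def[abs_def] by (intro borel_measurable_sum S_past) auto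

lemma jump_time_measurable [measurable]: "jump_time j \<in> borel_measurable M"
  unfolding jump_time_def[abs_def] by measurable

lemma jump_time_0 [simp]: "jump_time 0 \<omega> = 0"
  by (simp add: jump_time_def)

lemma jump_time_Suc: "jump_time (Suc k) \<omega> = jump_time k \<omega> + S k \<omega>"
  by (simp add: jump_time_def)

lemma jump_time_nonneg: "\<omega> \<in> space M \<Longrightarrow> 0 \<le> jump_time k \<omega>"
  unfolding jump_time_def by (intro sum_nonneg) (auto intro: less_imp_le S_pos)

lemma jump_time_strict: "\<omega> \<in> space M \<Longrightarrow> j < k \<Longrightarrow> jump_time j \<omega> < jump_time k \<omega>"
  by (induction k) (auto simp: jump_time_Suc less_Suc_eq S_pos add_strict_increasing2
      intro: less_trans)

lemma jump_time_mono: "\<omega> \<in> space M \<Longrightarrow> j \<le> k \<Longrightarrow> jump_time j \<omega> \<le> jump_time k \<omega>"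
  using jump_time_strict[of \<omega> j k] by (cases "j = k") auto

section \<open>The one-step Markov property\<close>

lemma prob_step_cylinder:
  assumes s: "\<And>j. 0 \<le> s j" and a: "0 \<le> a"
  shows "prob (cylinder k z s \<inter> {\<omega>\<in>space M. Z k \<omega> = u \<and> a < S k \<omega> \<and> Z (Suc k) \<omega> = v}) =
    exp (- exit_rate q u * a) * jump_prob q u v * prob (cylinder k z s \<inter> {\<omega>\<in>space M. Z k \<omega> = u})"
proof (cases "z k = u")
  case True
  \<comment> \<open>Prescribing the next sojourn and state turns the cylinder into one that is
    longer by one step, so the two instances of \<open>law\<close> differ exactly by the factor with
    index \<open>k\<close>.\<close>
  let ?z = "z(Suc k := v)" and ?s = "s(k := a)"
  have "cylinder k z s \<inter> {\<omega>\<in>space M. Z k \<omega> = u \<and> a < S k \<omega> \<and> Z (Suc k) \<omega> = v} =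
      cylinder (Suc k) ?z ?s"
    using True by (auto simp: cylinder_def less_Suc_eq le_Suc_eq)
  moreover have "cylinder k z s \<inter> {\<omega>\<in>space M. Z k \<omega> = u} = cylinder k z s"
    using True by (auto simp: cylinder_def)
  moreover have "(\<Prod>j<k. exp (- exit_rate q (?z j) * ?s j) * jump_prob q (?z j) (?z (Suc j))) =
      (\<Prod>j<k. exp (- exit_rate q (z j) * s j) * jump_prob q (z j) (z (Suc j)))"
    by (rule prod.cong) auto
  ultimately show ?thesis
    using law[of ?s "Suc k" ?z] law[of s k z] assms True
    by (simp add: cylinder_def)
next
  case False
  then have "cylinder k z s \<inter> {\<omega>\<in>space M. Z k \<omega> = u \<and> a < S k \<omega> \<and> Z (Suc k) \<omega> = v} = {}"
    "cylinder k z s \<inter> {\<omega>\<in>space M. Z k \<omega> = u} = {}"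
    by (auto simp: cylinder_def)
  then show ?thesis by (simp only: measure_empty mult_zero_right)
qed

lemma Int_stable_cylinders: "Int_stable (insert {} {cylinder k z s | z s. \<forall>j. 0 \<le> s j})"
  (is "Int_stable ?E")
proof (rule Int_stableI)
  fix a b assume ab: "a \<in> ?E" "b \<in> ?E"
  show "a \<inter> b \<in> ?E"
  proof (cases "a \<inter> b = {}")
    case False
    with ab obtain z s z' s' where *: "a = cylinder k z s" "b = cylinder k z' s'"
      "\<forall>j. 0 \<le> s j" "\<forall>j. 0 \<le> s' j"
      by blast
    with False have "\<forall>j\<le>k. z j = z' j" by (auto simp: cylinder_def)
    with * have "a \<inter> b = cylinder k z (\<lambda>j. max (s j) (s' j))"
      by (auto simp: cylinder_def)
    moreover have "\<forall>j. 0 \<le> max (s j) (s' j)"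
      using * by (auto simp: max_def)
    ultimately show ?thesis by blast
  qed simp
qed

text \<open>Given the past and \<open>Z k = u\<close>, the sojourn time has an exponential tail and
  the next state is independent of it. As functions of \<open>A\<close> both sides are finite
  measures on \<open>past k\<close>, so agreement on the pi-system of cylinders is enough.\<close>

lemma emeasure_step:
  assumes A: "A \<in> sets (past k)" and a: "0 \<le> a"
  shows "emeasure M (A \<inter> {\<omega>\<in>space M. Z k \<omega> = u \<and> a < S k \<omega> \<and> Z (Suc k) \<omega> = v}) =
    ennreal (exp (- exit_rate q u * a) * jump_prob q u v) *
      emeasure M (A \<inter> {\<omega>\<in>space M. Z k \<omega> = u})"
proof -
  let ?E = "insert {} {cylinder k z s | z s. \<forall>j. 0 \<le> s j}"
  let ?c = "exp (- exit_rate q u * a) * jump_prob q u v"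
  let ?B = "{\<omega>\<in>space M. Z k \<omega> = u \<and> a < S k \<omega> \<and> Z (Suc k) \<omega> = v}"
  let ?C = "{\<omega>\<in>space M. Z k \<omega> = u}"
  define N1 where "N1 = restr_to_subalg (density M (indicator ?B)) (past k)"
  define N2 where "N2 = scale_measure (ennreal ?c) (restr_to_subalg (density M (indicator ?C)) (past k))"
  have sub: "subalgebra (density M f) (past k)" for f
    using subalgebra_past[of k] by (auto simp: subalgebra_def)
  have e1: "emeasure N1 X = emeasure M (X \<inter> ?B)" if "X \<in> sets (past k)" for X
    using that by (simp add: N1_def emeasure_restr_to_subalg[OF sub] emeasure_restricted past_sets Int_commute)
  have e2: "emeasure N2 X = ennreal ?c * emeasure M (X \<inter> ?C)" if "X \<in> sets (past k)" for X
    using that by (simp add: N2_def emeasure_restr_to_subalg[OF sub] emeasure_restricted past_sets Int_commute)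
  have "N1 = N2"
  proof (rule measure_eqI_generator_eq[OF Int_stable_cylinders])
    show "?E \<subseteq> Pow (space M)" by (auto simp: cylinder_def)
    show "sets N1 = sigma_sets (space M) ?E" "sets N2 = sigma_sets (space M) ?E"
      by (simp_all add: N1_def N2_def sets_restr_to_subalg[OF sub] sets_past)
    show "emeasure N1 X = emeasure N2 X" if "X \<in> ?E" for X
    proof -
      have X: "X \<in> sets (past k)" using that unfolding sets_past by (rule sigma_sets.Basic)
      have "emeasure M (X \<inter> ?B) = ennreal ?c * emeasure M (X \<inter> ?C)"
      proof (cases "X = {}")
        case False
        with that obtain z s where Xeq: "X = cylinder k z s" and s: "\<And>j. 0 \<le> s j" by auto
        have "prob (X \<inter> ?B) = ?c * prob (X \<inter> ?C)"
          unfolding Xeq by (rule prob_step_cylinder[OF s a])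
        then show ?thesis
          by (simp add: emeasure_eq_measure ennreal_mult jump_prob_nonneg)
      qed simp
      then show ?thesis using X by (simp add: e1 e2)
    qed
    \<comment> \<open>The uniqueness theorem asks for a countable cover by generators of finite
      measure: all initial segments, enumerated through their codes, with no constraint on the
      sojourns.\<close>
    let ?A = "\<lambda>i. cylinder k (\<lambda>j. (from_nat i :: 's list) ! j) (\<lambda>_. 0)"
    show "range ?A \<subseteq> ?E" by auto
    show "(\<Union>i. ?A i) = space M"
    proof safe
      fix \<omega> assume \<omega>: "\<omega> \<in> space M"
      obtain p :: "'s list" where "\<And>j. j \<le> k \<Longrightarrow> p ! j = Z j \<omega>"
        using cylinder_cover[OF \<omega>] by metis
      then have "\<omega> \<in> ?A (to_nat p)" using \<omega> S_pos by (auto simp: cylinder_def)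
      then show "\<omega> \<in> (\<Union>i. ?A i)" by blast
    qed (auto simp: cylinder_def)
    show "emeasure N1 (?A i) \<noteq> \<infinity>" for i
      by (simp add: e1 cylinder_past)
  qed
  then show ?thesis using e1[OF A] e2[OF A] by simp
qed

text \<open>Passes from the tails of \<open>S k\<close> to its whole law: finite measures on the
  reals that agree on all half-lines \<open>{x<..}\<close> are equal.\<close>

lemma emeasure_step_borel:
  assumes A: "A \<in> sets (past k)" and B: "B \<in> sets borel"
  shows "emeasure M (A \<inter> {\<omega>\<in>space M. Z k \<omega> = u \<and> S k \<omega> \<in> B \<and> Z (Suc k) \<omega> = v}) =
    ennreal (jump_prob q u v) * emeasure M (A \<inter> {\<omega>\<in>space M. Z k \<omega> = u}) *
      emeasure (density lborel (exponential_density (exit_rate q u))) B"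
proof -
  let ?D = "density lborel (exponential_density (exit_rate q u))"
  let ?R = "A \<inter> {\<omega>\<in>space M. Z k \<omega> = u \<and> Z (Suc k) \<omega> = v}"
  have [measurable]: "A \<in> sets M" using past_sets[OF A] .
  interpret D: prob_space ?D
    by (rule prob_space_exponential_density[OF exit_rate_pos])
  define N1 where "N1 = distr (density M (indicator ?R)) borel (S k)"
  define N2 where "N2 = scale_measure (ennreal (jump_prob q u v) * emeasure M (A \<inter> {\<omega>\<in>space M. Z k \<omega> = u})) ?D"
  have e1: "emeasure N1 X = emeasure M (A \<inter> {\<omega>\<in>space M. Z k \<omega> = u \<and> S k \<omega> \<in> X \<and> Z (Suc k) \<omega> = v})"
    if [measurable]: "X \<in> sets borel" for X
    unfolding N1_def
    by (subst emeasure_distr, simp, simp, subst emeasure_restricted)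
       (auto intro!: arg_cong[where f = "emeasure M"])
  have "N1 = N2"
  proof (rule measure_eqI_lessThan)
    show "sets N1 = sets borel" "sets N2 = sets borel" by (simp_all add: N1_def N2_def)
    show "emeasure N1 {x<..} < \<infinity>" for x by (simp add: e1 less_top[symmetric])
    show "emeasure N1 {x<..} = emeasure N2 {x<..}" for x
    proof -
      have "{\<omega>\<in>space M. Z k \<omega> = u \<and> S k \<omega> \<in> {x<..} \<and> Z (Suc k) \<omega> = v} =
          {\<omega>\<in>space M. Z k \<omega> = u \<and> max x 0 < S k \<omega> \<and> Z (Suc k) \<omega> = v}"
        using S_pos by auto
      then have 1: "emeasure N1 {x<..} = ennreal (exp (- exit_rate q u * max x 0) * jump_prob q u v) *
          emeasure M (A \<inter> {\<omega>\<in>space M. Z k \<omega> = u})"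
        using emeasure_step[OF A, of "max x 0" u v] by (simp add: e1)
      have "emeasure ?D {x<..} = emeasure ?D {max x 0<..}"
        by (simp add: emeasure_density, rule nn_integral_cong_AE,
            rule AE_I[where N = "{0}"])
           (auto split: split_indicator simp: exponential_density_def max_def)
      then have "emeasure ?D {x<..} = ennreal (exp (- exit_rate q u * max x 0))"
        using emeasure_exponential_greaterThan[OF exit_rate_pos, of "max x 0" u] by simp
      with 1 show ?thesis
        by (simp add: N2_def ennreal_mult jump_prob_nonneg mult_ac)
    qed
  qed
  then show ?thesis using e1[OF B] by (simp add: N2_def)
qed

text \<open>The jump time is determined by the past and the sojourn after it is not, so on the event
  in question the joint law of \<open>jump_time k\<close> and \<open>S k\<close> is a product
  measure and Tonelli applies. Both arguments are kept because the later integrand depends on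
  absolute time and is cut off at \<open>T\<close>.\<close>

lemma nn_integral_step:
  assumes A: "A \<in> sets (past k)"
    and f [measurable]: "case_prod f \<in> borel_measurable (borel \<Otimes>\<^sub>M borel)"
  shows "(\<integral>\<^sup>+\<omega>. indicator (A \<inter> {\<omega>\<in>space M. Z k \<omega> = u \<and> Z (Suc k) \<omega> = v}) \<omega> *
        f (jump_time k \<omega>) (S k \<omega>) \<partial>M) =
    (\<integral>\<^sup>+\<omega>. indicator (A \<inter> {\<omega>\<in>space M. Z k \<omega> = u}) \<omega> * (ennreal (jump_prob q u v) *
        (\<integral>\<^sup>+s. f (jump_time k \<omega>) s \<partial>density lborel (exponential_density (exit_rate q u)))) \<partial>M)"
proof -
  let ?D = "density lborel (exponential_density (exit_rate q u))"
  let ?R = "A \<inter> {\<omega>\<in>space M. Z k \<omega> = u \<and> Z (Suc k) \<omega> = v}"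
  let ?C = "A \<inter> {\<omega>\<in>space M. Z k \<omega> = u}"
  have [measurable]: "A \<in> sets M" using past_sets[OF A] .
  interpret D: prob_space ?D
    by (rule prob_space_exponential_density[OF exit_rate_pos])
  \<comment> \<open>The weight \<open>jump_prob q u v\<close> and the event \<open>Z k = u\<close>
    go into the first factor, so the product has the right total mass without conditioning.\<close>
  define P where "P = distr (density M (\<lambda>\<omega>. ennreal (jump_prob q u v) * indicator ?C \<omega>)) borel (jump_time k)"
  define N where "N = distr (density M (indicator ?R)) (borel \<Otimes>\<^sub>M borel) (\<lambda>\<omega>. (jump_time k \<omega>, S k \<omega>))"
  have emeasure_P: "emeasure P X = ennreal (jump_prob q u v) *
      emeasure M (A \<inter> {\<omega>\<in>space M. jump_time k \<omega> \<in> X} \<inter> {\<omega>\<in>space M. Z k \<omega> = u})"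
    if [measurable]: "X \<in> sets borel" for X
  proof -
    have "emeasure P X = (\<integral>\<^sup>+\<omega>. ennreal (jump_prob q u v) *
        indicator (A \<inter> {\<omega>\<in>space M. jump_time k \<omega> \<in> X} \<inter> {\<omega>\<in>space M. Z k \<omega> = u}) \<omega> \<partial>M)"
      unfolding P_def
      by (subst emeasure_distr, simp, simp, subst emeasure_density)
         (auto intro!: nn_integral_cong split: split_indicator)
    then show ?thesis by (simp add: nn_integral_cmult)
  qed
  have [measurable_cong]: "sets P = sets borel" "sets N = sets (borel \<Otimes>\<^sub>M borel)"
    by (simp_all add: P_def N_def)
  have "finite_measure P"
  proof
    have "space P = space borel" by (simp add: P_def)
    then show "emeasure P (space P) \<noteq> \<infinity>"
      using emeasure_P[of UNIV] by (simp add: ennreal_mult_eq_top_iff)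
  qed
  then interpret P: finite_measure P .
  have "P \<Otimes>\<^sub>M ?D = N"
  proof (rule pair_measure_eqI)
    show "sigma_finite_measure P" "sigma_finite_measure ?D" by unfold_locales
    show "sets (P \<Otimes>\<^sub>M ?D) = sets N" by (simp add: N_def P_def cong: sets_pair_measure_cong)
    fix X Y assume "X \<in> sets P" "Y \<in> sets ?D"
    then have XY [measurable]: "X \<in> sets borel" "Y \<in> sets borel" by (simp_all add: P_def)
    have "A \<inter> {\<omega>\<in>space M. jump_time k \<omega> \<in> X} \<in> sets (past k)"
      using A measurable_sets[OF jump_time_past[of k k], of X]
      by (intro sets.Int) (auto simp: vimage_def Int_def conj_commute)
    from emeasure_step_borel[OF this XY(2), of u v]
    have "emeasure P X * emeasure ?D Y = emeasure M (A \<inter> {\<omega>\<in>space M. jump_time k \<omega> \<in> X} \<inter>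
       {\<omega>\<in>space M. Z k \<omega> = u \<and> S k \<omega> \<in> Y \<and> Z (Suc k) \<omega> = v})"
      by (simp add: emeasure_P)
    also have "\<dots> = emeasure N (X \<times> Y)"
      unfolding N_def
      by (subst emeasure_distr, simp, simp, subst emeasure_restricted)
         (auto intro!: arg_cong[where f = "emeasure M"])
    finally show "emeasure P X * emeasure ?D Y = emeasure N (X \<times> Y)" .
  qed
  have "(\<integral>\<^sup>+\<omega>. indicator ?R \<omega> * f (jump_time k \<omega>) (S k \<omega>) \<partial>M) = (\<integral>\<^sup>+x. case_prod f x \<partial>N)"
    unfolding N_def by (subst nn_integral_distr, simp, simp, subst nn_integral_density) auto
  also have "\<dots> = (\<integral>\<^sup>+t. \<integral>\<^sup>+s. f t s \<partial>?D \<partial>P)"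
    unfolding \<open>P \<Otimes>\<^sub>M ?D = N\<close>[symmetric] by (subst D.nn_integral_fst[symmetric]) simp_all
  also have "\<dots> = (\<integral>\<^sup>+\<omega>. (ennreal (jump_prob q u v) * indicator ?C \<omega>) * (\<integral>\<^sup>+s. f (jump_time k \<omega>) s \<partial>?D) \<partial>M)"
    unfolding P_def by (subst nn_integral_distr, simp, simp, subst nn_integral_density) auto
  finally show ?thesis by (simp add: mult_ac)
qed

text \<open>Integrated form of a bound on the conditional expectation over one jump. The integral is
  split over the countably many values of \<open>Z k\<close> and \<open>Z (Suc k)\<close>, and the
  bound is required only on \<open>A\<close>, the set of paths that are still under control.\<close>

lemma nn_integral_step_le:
  assumes A: "A \<in> sets (past k)"
    and f [measurable]: "\<And>u v. case_prod (f u v) \<in> borel_measurable (borel \<Otimes>\<^sub>M borel)"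
    and g [measurable]: "\<And>u. g u \<in> borel_measurable borel"
    and le: "\<And>\<omega>. \<omega> \<in> A \<Longrightarrow>
      (\<integral>\<^sup>+v. ennreal (jump_prob q (Z k \<omega>) v) * (\<integral>\<^sup>+s. f (Z k \<omega>) v (jump_time k \<omega>) s
        \<partial>density lborel (exponential_density (exit_rate q (Z k \<omega>)))) \<partial>count_space UNIV)
      \<le> g (Z k \<omega>) (jump_time k \<omega>)"
  shows "(\<integral>\<^sup>+\<omega>. indicator A \<omega> * f (Z k \<omega>) (Z (Suc k) \<omega>) (jump_time k \<omega>) (S k \<omega>) \<partial>M) \<le>
    (\<integral>\<^sup>+\<omega>. indicator A \<omega> * g (Z k \<omega>) (jump_time k \<omega>) \<partial>M)"
proof -
  let ?D = "\<lambda>u. density lborel (exponential_density (exit_rate q u))"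
  let ?R = "\<lambda>u v. A \<inter> {\<omega>\<in>space M. Z k \<omega> = u \<and> Z (Suc k) \<omega> = v}"
  let ?C = "\<lambda>u. A \<inter> {\<omega>\<in>space M. Z k \<omega> = u}"
  have [measurable]: "A \<in> sets M" using past_sets[OF A] .
  have A_sub: "A \<subseteq> space M" using sets.sets_into_space[of A M] by simp
  have [simp]: "sigma_finite_measure (?D u)" for u
    using prob_space_exponential_density[OF exit_rate_pos, of u] prob_space_imp_sigma_finite by blast
  have [measurable]: "(\<lambda>t. \<integral>\<^sup>+s. f u v t s \<partial>?D u) \<in> borel_measurable borel" for u v
    by (rule sigma_finite_measure.borel_measurable_nn_integral) simp_all
  have single: "(\<integral>\<^sup>+x. indicator (X x) \<omega> * h x \<partial>count_space UNIV) = indicator B \<omega> * h y"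
    if "\<And>x. \<omega> \<in> X x \<longleftrightarrow> \<omega> \<in> B \<and> x = y" for X B y \<omega> and h :: "'x \<Rightarrow> ennreal"
  proof -
    have "(\<integral>\<^sup>+x. indicator (X x) \<omega> * h x \<partial>count_space UNIV) =
        (\<integral>\<^sup>+x. indicator B \<omega> * h y * indicator {y} x \<partial>count_space UNIV)"
      by (intro nn_integral_cong) (auto simp: that split: split_indicator)
    then show ?thesis by simp
  qed
  have "(\<integral>\<^sup>+\<omega>. indicator A \<omega> * f (Z k \<omega>) (Z (Suc k) \<omega>) (jump_time k \<omega>) (S k \<omega>) \<partial>M) =
    (\<integral>\<^sup>+\<omega>. \<integral>\<^sup>+u. \<integral>\<^sup>+v. indicator (?R u v) \<omega> * f u v (jump_time k \<omega>) (S k \<omega>)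
      \<partial>count_space UNIV \<partial>count_space UNIV \<partial>M)"
  proof (rule nn_integral_cong)
    fix \<omega> assume \<omega>: "\<omega> \<in> space M"
    have "(\<integral>\<^sup>+v. indicator (?R u v) \<omega> * f u v (jump_time k \<omega>) (S k \<omega>) \<partial>count_space UNIV) =
       indicator (?C u) \<omega> * f u (Z (Suc k) \<omega>) (jump_time k \<omega>) (S k \<omega>)" for u
      by (rule single) (use \<omega> in auto)
    moreover have "(\<integral>\<^sup>+u. indicator (?C u) \<omega> * f u (Z (Suc k) \<omega>) (jump_time k \<omega>) (S k \<omega>) \<partial>count_space UNIV) =
       indicator A \<omega> * f (Z k \<omega>) (Z (Suc k) \<omega>) (jump_time k \<omega>) (S k \<omega>)"
      by (rule single) (use \<omega> in auto)
    ultimately show "indicator A \<omega> * f (Z k \<omega>) (Z (Suc k) \<omega>) (jump_time k \<omega>) (S k \<omega>) =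
      (\<integral>\<^sup>+u. \<integral>\<^sup>+v. indicator (?R u v) \<omega> * f u v (jump_time k \<omega>) (S k \<omega>)
        \<partial>count_space UNIV \<partial>count_space UNIV)"
      by presburger
  qed
  also have "\<dots> = (\<integral>\<^sup>+u. \<integral>\<^sup>+\<omega>. \<integral>\<^sup>+v. indicator (?R u v) \<omega> * f u v (jump_time k \<omega>) (S k \<omega>)
      \<partial>count_space UNIV \<partial>M \<partial>count_space UNIV)"
    by (rule nn_integral_count_space_nn_integral)
       (simp_all add: borel_measurable_nn_integral_countable)
  also have "\<dots> = (\<integral>\<^sup>+u. \<integral>\<^sup>+v. \<integral>\<^sup>+\<omega>. indicator (?R u v) \<omega> * f u v (jump_time k \<omega>) (S k \<omega>) \<partial>M
      \<partial>count_space UNIV \<partial>count_space UNIV)"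
    by (rule nn_integral_cong, rule nn_integral_count_space_nn_integral) simp_all
  also have "\<dots> = (\<integral>\<^sup>+u. \<integral>\<^sup>+v. \<integral>\<^sup>+\<omega>. indicator (?C u) \<omega> * (ennreal (jump_prob q u v) *
        (\<integral>\<^sup>+s. f u v (jump_time k \<omega>) s \<partial>?D u)) \<partial>M \<partial>count_space UNIV \<partial>count_space UNIV)"
    by (rule nn_integral_cong, rule nn_integral_cong, rule nn_integral_step[OF A f])
  also have "\<dots> = (\<integral>\<^sup>+u. \<integral>\<^sup>+\<omega>. \<integral>\<^sup>+v. indicator (?C u) \<omega> * (ennreal (jump_prob q u v) *
        (\<integral>\<^sup>+s. f u v (jump_time k \<omega>) s \<partial>?D u)) \<partial>count_space UNIV \<partial>M \<partial>count_space UNIV)"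
    by (rule nn_integral_cong, rule nn_integral_count_space_nn_integral[symmetric]) simp_all
  also have "\<dots> = (\<integral>\<^sup>+u. \<integral>\<^sup>+\<omega>. indicator (?C u) \<omega> * (\<integral>\<^sup>+v. ennreal (jump_prob q u v) *
        (\<integral>\<^sup>+s. f u v (jump_time k \<omega>) s \<partial>?D u) \<partial>count_space UNIV) \<partial>M \<partial>count_space UNIV)"
    by (rule nn_integral_cong, rule nn_integral_cong, rule nn_integral_cmult) simp
  also have "\<dots> \<le> (\<integral>\<^sup>+u. \<integral>\<^sup>+\<omega>. indicator (?C u) \<omega> * g u (jump_time k \<omega>) \<partial>M \<partial>count_space UNIV)"
    by (intro nn_integral_mono) (auto split: split_indicator intro: le)
  also have "\<dots> = (\<integral>\<^sup>+\<omega>. \<integral>\<^sup>+u. indicator (?C u) \<omega> * g u (jump_time k \<omega>) \<partial>count_space UNIV \<partial>M)"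
    by (rule nn_integral_count_space_nn_integral[symmetric]) simp_all
  also have "\<dots> = (\<integral>\<^sup>+\<omega>. indicator A \<omega> * g (Z k \<omega>) (jump_time k \<omega>) \<partial>M)"
    by (intro nn_integral_cong single) auto
  finally show ?thesis .
qed

end

section \<open>A maximal inequality at the jump times\<close>

context jump_chain begin

text \<open>Between two jumps the path is inspected only at the end points, the last of which is cut off
  at \<open>T\<close>; a function that is monotone along each sojourn has its extrema there.\<close>

definition exceeds :: "('s \<Rightarrow> real \<Rightarrow> real) \<Rightarrow> real \<Rightarrow> real \<Rightarrow> nat \<Rightarrow> 'w \<Rightarrow> bool" where
  "exceeds W T w k \<omega> \<longleftrightarrow> jump_time k \<omega> \<le> T \<and>
     w \<le> (if jump_time (Suc k) \<omega> \<le> T then W (Z (Suc k) \<omega>) (jump_time (Suc k) \<omega>) else W (Z k \<omega>) T)"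

lemma exceeds_measurable:
  assumes [measurable]: "\<And>u. W u \<in> borel_measurable borel"
  shows "Measurable.pred M (exceeds W T w k)"
proof -
  have [measurable]: "(\<lambda>\<omega>. W (Z j \<omega>) (g \<omega>)) \<in> borel_measurable M"
    if [measurable]: "g \<in> borel_measurable M" for j g
    by (rule measurable_compose_countable[where f = "\<lambda>u \<omega>. W u (g \<omega>)" and g = "Z j"]) measurable
  show ?thesis unfolding exceeds_def[abs_def] by measurable
qed

text \<open>The optional stopping argument for nonnegative supermartingales, written as a
  telescoping sum. \<open>\<Phi> k\<close> is the mass of \<open>W\<close> carried by the paths that
  have stayed below \<open>w\<close>; one step lowers it by at least \<open>w\<close> times the
  probability of the first exceedance in that step. Hence \<open>w\<close> times the probability of
  ever exceeding is at most \<open>\<Phi> 0\<close>, which is at most \<open>\<eta>\<close>. Paths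
  are dropped once they exceed, so \<open>step\<close> is only asked for where
  \<open>W u t < w\<close>.\<close>

lemma maximal_inequality:
  fixes W :: "'s \<Rightarrow> real \<Rightarrow> real"
  assumes W [measurable]: "\<And>u. W u \<in> borel_measurable borel"
    and step: "\<And>u t. 0 \<le> t \<Longrightarrow> t \<le> T \<Longrightarrow> W u t < w \<Longrightarrow>
      (\<integral>\<^sup>+v. ennreal (jump_prob q u v) *
        (\<integral>\<^sup>+s. (if t + s \<le> T then ennreal (W v (t + s)) else ennreal (W u T))
          \<partial>density lborel (exponential_density (exit_rate q u))) \<partial>count_space UNIV)
      \<le> ennreal (W u t)"
    and T: "0 \<le> T" and w: "0 < w" and \<eta>: "0 \<le> \<eta>" "\<eta> < w"
  shows "prob {\<omega>\<in>space M. W (Z 0 \<omega>) 0 \<le> \<eta> \<and> (\<exists>k. exceeds W T w k \<omega>)} \<le> \<eta> / w"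
proof -
  define alive where "alive k = {\<omega>\<in>space M. W (Z 0 \<omega>) 0 \<le> \<eta> \<and> jump_time k \<omega> \<le> T \<and>
    (\<forall>j\<le>k. W (Z j \<omega>) (jump_time j \<omega>) < w)}" for k
  define bad where "bad k = {\<omega>\<in>alive k. exceeds W T w k \<omega>}" for k
  define \<Phi> where "\<Phi> k = (\<integral>\<^sup>+\<omega>. indicator (alive k) \<omega> * ennreal (W (Z k \<omega>) (jump_time k \<omega>)) \<partial>M)" for k
  define f where "f u v t s = (if t + s \<le> T then ennreal (W v (t + s)) else ennreal (W u T))" for u v t s
  have f: "case_prod (f u v) \<in> borel_measurable (borel \<Otimes>\<^sub>M borel)" for u v
    unfolding f_def[abs_def] split_beta by measurable
  have Wj: "(\<lambda>\<omega>. W (Z j \<omega>) (jump_time j \<omega>)) \<in> borel_measurable (past k)" if "j \<le> k" for j k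
  proof (rule measurable_compose_countable[where f = "\<lambda>u \<omega>. W u (jump_time j \<omega>)" and g = "Z j"])
    show "(\<lambda>\<omega>. W u (jump_time j \<omega>)) \<in> borel_measurable (past k)" for u
      using measurable_compose[OF jump_time_past[OF that] W] .
  qed (rule Z_past[OF that])
  have alive: "alive k \<in> sets (past k)" for k
  proof -
    have [measurable]: "(\<lambda>\<omega>. W (Z 0 \<omega>) 0) \<in> borel_measurable (past k)"
      using Wj[of 0 k] by simp
    have [measurable]: "jump_time k \<in> borel_measurable (past k)"
      by (rule jump_time_past) simp
    have "{\<omega>\<in>space (past k). \<forall>j\<in>{..k}. W (Z j \<omega>) (jump_time j \<omega>) < w} \<in> sets (past k)"
      using borel_measurable_less[OF Wj borel_measurable_const]
      by (intro sets.sets_Collect_finite_All') auto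
    moreover have "{\<omega>\<in>space (past k). W (Z 0 \<omega>) 0 \<le> \<eta> \<and> jump_time k \<omega> \<le> T} \<in> sets (past k)"
      by measurable
    moreover have "alive k = {\<omega>\<in>space (past k). \<forall>j\<in>{..k}. W (Z j \<omega>) (jump_time j \<omega>) < w} \<inter>
        {\<omega>\<in>space (past k). W (Z 0 \<omega>) 0 \<le> \<eta> \<and> jump_time k \<omega> \<le> T}"
      unfolding alive_def by auto
    ultimately show ?thesis by simp
  qed
  have [measurable]: "alive k \<in> sets M" for k by (rule past_sets[OF alive])
  have [measurable]: "bad k \<in> sets M" for k
  proof -
    have "bad k = alive k \<inter> {\<omega>\<in>space M. exceeds W T w k \<omega>}"
      by (auto simp: bad_def alive_def)
    then show ?thesis using exceeds_measurable[OF W, where T = T and w = w and k = k] by simp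
  qed
  have [measurable]: "(\<lambda>\<omega>. W (Z j \<omega>) (jump_time j \<omega>)) \<in> borel_measurable M" for j
    using measurable_from_subalg[OF subalgebra_past Wj[of j j]] by simp
  have \<Phi>_Suc: "ennreal w * emeasure M (bad k) + \<Phi> (Suc k) \<le> \<Phi> k" for k
  proof -
    have "ennreal w * emeasure M (bad k) + \<Phi> (Suc k) =
        (\<integral>\<^sup>+\<omega>. ennreal w * indicator (bad k) \<omega> + indicator (alive (Suc k)) \<omega> *
          ennreal (W (Z (Suc k) \<omega>) (jump_time (Suc k) \<omega>)) \<partial>M)"
      unfolding \<Phi>_def by (subst nn_integral_add) (simp_all add: nn_integral_cmult)
    also have "\<dots> \<le> (\<integral>\<^sup>+\<omega>. indicator (alive k) \<omega> *
        f (Z k \<omega>) (Z (Suc k) \<omega>) (jump_time k \<omega>) (S k \<omega>) \<partial>M)"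
    proof (rule nn_integral_mono)
      fix \<omega> assume \<omega>: "\<omega> \<in> space M"
      \<comment> \<open>\<open>bad k\<close> and \<open>alive (Suc k)\<close> are disjoint parts of
        \<open>alive k\<close>. On the first the integrand \<open>f\<close> is at least
        \<open>w\<close>; on the second the jump comes before \<open>T\<close>, so \<open>f\<close>
        is the value of \<open>W\<close> right after it.\<close>
      have "alive (Suc k) \<subseteq> alive k"
        using jump_time_mono[of _ k "Suc k"] by (force simp: alive_def)
      moreover have "jump_time (Suc k) \<omega> \<le> T" if "\<omega> \<in> alive (Suc k)"
        using that by (auto simp: alive_def)
      moreover have "\<omega> \<notin> bad k" if "\<omega> \<in> alive (Suc k)"
        using that by (auto simp: alive_def bad_def exceeds_def not_le)
      moreover have "w \<le> (if jump_time (Suc k) \<omega> \<le> T then W (Z (Suc k) \<omega>) (jump_time (Suc k) \<omega>) else W (Z k \<omega>) T)"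
        if "\<omega> \<in> bad k"
        using that by (auto simp: bad_def exceeds_def)
      moreover have "bad k \<subseteq> alive k" by (auto simp: bad_def)
      ultimately show "ennreal w * indicator (bad k) \<omega> + indicator (alive (Suc k)) \<omega> *
          ennreal (W (Z (Suc k) \<omega>) (jump_time (Suc k) \<omega>)) \<le>
          indicator (alive k) \<omega> * f (Z k \<omega>) (Z (Suc k) \<omega>) (jump_time k \<omega>) (S k \<omega>)"
        by (auto simp: f_def jump_time_Suc indicator_def ennreal_leI split: if_splits)
    qed
    also have "\<dots> \<le> (\<integral>\<^sup>+\<omega>. indicator (alive k) \<omega> * ennreal (W (Z k \<omega>) (jump_time k \<omega>)) \<partial>M)"
    proof (rule nn_integral_step_le[OF alive f])
      fix \<omega> assume "\<omega> \<in> alive k"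
      then show "(\<integral>\<^sup>+v. ennreal (jump_prob q (Z k \<omega>) v) * (\<integral>\<^sup>+s. f (Z k \<omega>) v (jump_time k \<omega>) s
          \<partial>density lborel (exponential_density (exit_rate q (Z k \<omega>)))) \<partial>count_space UNIV)
        \<le> ennreal (W (Z k \<omega>) (jump_time k \<omega>))"
        unfolding f_def by (intro step) (auto simp: alive_def jump_time_nonneg)
    qed measurable
    finally show ?thesis by (simp add: \<Phi>_def)
  qed
  have sum: "(\<Sum>k<N. ennreal w * emeasure M (bad k)) + \<Phi> N \<le> \<Phi> 0" for N
  proof (induction N)
    case (Suc N)
    have "(\<Sum>k<Suc N. ennreal w * emeasure M (bad k)) + \<Phi> (Suc N) =
        (\<Sum>k<N. ennreal w * emeasure M (bad k)) + (ennreal w * emeasure M (bad N) + \<Phi> (Suc N))"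
      by (simp add: add.assoc)
    also have "\<dots> \<le> (\<Sum>k<N. ennreal w * emeasure M (bad k)) + \<Phi> N"
      by (intro add_left_mono \<Phi>_Suc)
    finally show ?case using Suc by (rule order.trans)
  qed simp
  have "\<Phi> 0 \<le> (\<integral>\<^sup>+\<omega>. ennreal \<eta> \<partial>M)"
    unfolding \<Phi>_def by (intro nn_integral_mono) (auto simp: alive_def ennreal_leI split: split_indicator)
  also have "\<dots> = ennreal \<eta>" by (simp add: emeasure_space_1)
  finally have \<Phi>0: "\<Phi> 0 \<le> ennreal \<eta>" .
  let ?X = "{\<omega>\<in>space M. W (Z 0 \<omega>) 0 \<le> \<eta> \<and> (\<exists>k. exceeds W T w k \<omega>)}"
  have "?X \<subseteq> (\<Union>k. bad k)"
  proof
    fix \<omega> assume "\<omega> \<in> ?X"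
    then have \<omega>: "\<omega> \<in> space M" "W (Z 0 \<omega>) 0 \<le> \<eta>" and ex: "\<exists>k. exceeds W T w k \<omega>" by auto
    \<comment> \<open>The first exceedance occurs on an alive path: each earlier step not exceeding
      bounds \<open>W\<close> at the jump ending it, and the start is bounded by
      \<open>\<eta> < w\<close>.\<close>
    define k where "k = (LEAST k. exceeds W T w k \<omega>)"
    have k: "exceeds W T w k \<omega>" unfolding k_def using ex by (rule LeastI_ex)
    have less: "\<not> exceeds W T w i \<omega>" if "i < k" for i
      using that not_less_Least unfolding k_def by blast
    have "W (Z j \<omega>) (jump_time j \<omega>) < w" if "j \<le> k" for j
    proof (cases j)
      case 0
      then show ?thesis using \<omega> \<eta> by simp
    next
      case (Suc i)
      have "jump_time i \<omega> \<le> T" "jump_time j \<omega> \<le> T"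
        using k jump_time_mono[OF \<omega>(1), of i k] jump_time_mono[OF \<omega>(1), of j k] that Suc
        by (auto simp: exceeds_def)
      with less[of i] that Suc show ?thesis by (simp add: exceeds_def not_le)
    qed
    with k \<omega> show "\<omega> \<in> (\<Union>k. bad k)" by (auto simp: bad_def alive_def exceeds_def)
  qed
  then have "emeasure M ?X \<le> emeasure M (\<Union>k. bad k)"
    by (rule emeasure_mono) measurable
  also have "\<dots> \<le> (\<Sum>k. emeasure M (bad k))"
    by (rule emeasure_subadditive_countably) auto
  finally have "ennreal w * emeasure M ?X \<le> ennreal w * (\<Sum>k. emeasure M (bad k))"
    by (rule mult_left_mono) simp
  also have "\<dots> = (\<Sum>k. ennreal w * emeasure M (bad k))"
    by simp
  also have "\<dots> \<le> ennreal \<eta>"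
  proof (rule suminf_le_const[OF summableI])
    show "(\<Sum>k<N. ennreal w * emeasure M (bad k)) \<le> ennreal \<eta>" for N
      using order.trans[OF sum \<Phi>0, of N] by (metis add_increasing2 le_iff_add order.trans)
  qed
  finally have "ennreal (w * prob ?X) \<le> ennreal \<eta>"
    using w by (simp add: emeasure_eq_measure ennreal_mult)
  then have "w * prob ?X \<le> \<eta>" using \<eta> by (simp add: ennreal_le_iff)
  then show ?thesis using w by (simp add: field_simps)
qed

end

section \<open>Transition rates of the FCFS chain\<close>

definition remove_nth :: "nat \<Rightarrow> 'a list \<Rightarrow> 'a list" where
  "remove_nth j u = take j u @ drop (Suc j) u"

lemma length_remove_nth: "j < length u \<Longrightarrow> length (remove_nth j u) = length u - 1"
  by (simp add: remove_nth_def)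

lemma count_list_remove_nth:
  "j < length u \<Longrightarrow> count_list (remove_nth j u) i = count_list u i - (if u ! j = i then 1 else 0)"
  by (subst (2) id_take_nth_drop[of j u]) (auto simp: remove_nth_def)

text \<open>Rates and server needs are summed over positions, the Lyapunov function over classes.
  The semiring is left general because the identity is used with naturals for needs and with reals
  for rates.\<close>

lemma sum_nth_count_list:
  fixes g :: "'k::finite \<Rightarrow> 'b::semiring_1"
  shows "(\<Sum>j<length u. g (u ! j)) = (\<Sum>i\<in>UNIV. of_nat (count_list u i) * g i)"
proof (induction u)
  case (Cons a u)
  have "(\<Sum>j<length (a # u). g ((a # u) ! j)) = g a + (\<Sum>j<length u. g (u ! j))"
    by (simp add: sum.lessThan_Suc_shift del: sum.lessThan_Suc)
  also have "\<dots> = (\<Sum>i\<in>UNIV. (if a = i then g i else 0)) + (\<Sum>i\<in>UNIV. of_nat (count_list u i) * g i)"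
    by (simp add: Cons)
  also have "\<dots> = (\<Sum>i\<in>UNIV. of_nat (count_list (a # u) i) * g i)"
    by (subst sum.distrib[symmetric]) (auto intro!: sum.cong simp: algebra_simps)
  finally show ?case .
qed simp

lemma num_in_service_le: "num_in_service n m u \<le> length u"
proof -
  let ?A = "{k. k \<le> length u \<and> (\<Sum>j<k. m (u ! j)) \<le> n}"
  have "finite ?A" "0 \<in> ?A" by auto
  then have "Max ?A \<in> ?A" by (intro Max_in) blast+
  then show ?thesis by (simp add: num_in_service_def)
qed

lemma num_in_service_all:
  fixes m :: "'k::finite \<Rightarrow> nat"
  assumes "(\<Sum>i\<in>UNIV. count_list u i * m i) \<le> n"
  shows "num_in_service n m u = length u"
proof -
  have "(\<Sum>j<length u. m (u ! j)) \<le> n"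
    using assms by (simp add: sum_nth_count_list)
  then show ?thesis unfolding num_in_service_def by (intro Max_eqI) auto
qed

lemma fcfs_rate_nonneg:
  assumes "\<And>i. 0 \<le> lam i" "\<And>i. 0 \<le> \<mu> i"
  shows "0 \<le> fcfs_rate n lam m \<mu> u v"
  unfolding fcfs_rate_def using assms by (intro add_nonneg_nonneg sum_nonneg) auto

text \<open>A finite set outside which the rates out of \<open>u\<close> vanish; it turns the
  infinite sum in \<open>exit_rate\<close> and integrals against \<open>jump_prob\<close> into
  finite sums.\<close>

definition fcfs_succ :: "nat \<Rightarrow> ('k \<Rightarrow> nat) \<Rightarrow> 'k::finite list \<Rightarrow> 'k list set" where
  "fcfs_succ n m u = range (\<lambda>i. u @ [i]) \<union> (\<lambda>j. remove_nth j u) ` {..<num_in_service n m u}"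

lemma fcfs_rate_outside: "v \<notin> fcfs_succ n m u \<Longrightarrow> fcfs_rate n lam m \<mu> u v = 0"
  unfolding fcfs_rate_def fcfs_succ_def remove_nth_def
  by (subst (1 2) sum.neutral) (auto simp: image_iff)

lemma finite_fcfs_succ: "finite (fcfs_succ n m u)"
  by (simp add: fcfs_succ_def)

text \<open>Every transition changes the length of the list. Excluding the diagonal in
  \<open>exit_rate\<close> and \<open>jump_prob\<close> therefore loses no rate.\<close>

lemma not_in_fcfs_succ: "u \<notin> fcfs_succ n m u"
  using num_in_service_le[of n m u] length_remove_nth[of _ u]
  by (auto simp: fcfs_succ_def) (metis Suc_pred length_0_conv less_le_trans nat_neq_iff not_less0 length_greater_0_conv lessI)

text \<open>Exchanging the order of summation makes every class and every position hit exactly one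
  target, so departures of different jobs leading to the same list need no case distinction.\<close>

lemma sum_fcfs_rate:
  fixes g :: "'k::finite list \<Rightarrow> real"
  shows "(\<Sum>v\<in>fcfs_succ n m u. fcfs_rate n lam m \<mu> u v * g v) =
    (\<Sum>i\<in>UNIV. lam i * g (u @ [i])) + (\<Sum>j<num_in_service n m u. \<mu> (u ! j) * g (remove_nth j u))"
proof -
  let ?V = "fcfs_succ n m u"
  have "(\<Sum>v\<in>?V. fcfs_rate n lam m \<mu> u v * g v) =
     (\<Sum>v\<in>?V. (\<Sum>i\<in>UNIV. if v = u @ [i] then lam i * g v else 0)) +
     (\<Sum>v\<in>?V. (\<Sum>j<num_in_service n m u. if v = remove_nth j u then \<mu> (u ! j) * g v else 0))"
    by (subst sum.distrib[symmetric])
       (auto simp: fcfs_rate_def remove_nth_def distrib_right sum_distrib_right intro!: sum.cong arg_cong2[where f = "(+)"])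
  also have "(\<Sum>v\<in>?V. (\<Sum>i\<in>UNIV. if v = u @ [i] then lam i * g v else 0)) =
      (\<Sum>i\<in>UNIV. lam i * g (u @ [i]))"
    by (subst sum.swap, rule sum.cong) (simp_all add: finite_fcfs_succ, simp add: fcfs_succ_def)
  also have "(\<Sum>v\<in>?V. (\<Sum>j<num_in_service n m u. if v = remove_nth j u then \<mu> (u ! j) * g v else 0)) =
      (\<Sum>j<num_in_service n m u. \<mu> (u ! j) * g (remove_nth j u))"
    by (subst sum.swap, rule sum.cong) (simp_all add: finite_fcfs_succ, simp add: fcfs_succ_def)
  finally show ?thesis .
qed

lemma exit_rate_fcfs:
  "exit_rate (fcfs_rate n lam m \<mu>) u =
    (\<Sum>i\<in>UNIV. lam i) + (\<Sum>j<num_in_service n m u. \<mu> (u ! j))"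
proof -
  have "exit_rate (fcfs_rate n lam m \<mu>) u = (\<Sum>\<^sub>\<infinity>v\<in>fcfs_succ n m u. fcfs_rate n lam m \<mu> u v)"
    unfolding exit_rate_def
    by (rule infsum_cong_neutral) (use not_in_fcfs_succ[of u n m] in \<open>auto simp: fcfs_rate_outside\<close>)
  also have "\<dots> = (\<Sum>v\<in>fcfs_succ n m u. fcfs_rate n lam m \<mu> u v * 1)"
    by (simp add: finite_fcfs_succ)
  finally show ?thesis unfolding sum_fcfs_rate by simp
qed

lemma nn_integral_jump_prob_fcfs:
  fixes g :: "'k::finite list \<Rightarrow> ennreal" and g' :: "'k list \<Rightarrow> real"
    and lam \<mu> :: "'k \<Rightarrow> real" and m :: "'k \<Rightarrow> nat" and n :: nat
  defines "q \<equiv> fcfs_rate n lam m \<mu>"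
  assumes nonneg: "\<And>i. 0 \<le> lam i" "\<And>i. 0 \<le> \<mu> i" "\<And>v. 0 \<le> g' v"
    and g: "\<And>v. v \<in> fcfs_succ n m u \<Longrightarrow> g v = ennreal (g' v)"
    and r: "0 < exit_rate q u"
  shows "(\<integral>\<^sup>+v. ennreal (jump_prob q u v) * g v \<partial>count_space UNIV) =
    ennreal (((\<Sum>i\<in>UNIV. lam i * g' (u @ [i])) +
      (\<Sum>j<num_in_service n m u. \<mu> (u ! j) * g' (remove_nth j u))) / exit_rate q u)"
proof -
  let ?V = "fcfs_succ n m u"
  have nn: "0 \<le> jump_prob q u v" for v
    using r fcfs_rate_nonneg[OF nonneg(1,2), where n = n and m = m and u = u and v = v] by (simp add: jump_prob_def q_def)
  have jp: "jump_prob q u v = q u v / exit_rate q u" if "v \<in> ?V" for v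
    using that not_in_fcfs_succ[of u n m] by (auto simp: jump_prob_def)
  have "(\<integral>\<^sup>+v. ennreal (jump_prob q u v) * g v \<partial>count_space UNIV) =
      (\<Sum>v\<in>?V. ennreal (jump_prob q u v) * g v)"
    by (rule nn_integral_count_space'[OF finite_fcfs_succ])
       (auto simp: jump_prob_def q_def fcfs_rate_outside)
  also have "\<dots> = (\<Sum>v\<in>?V. ennreal (jump_prob q u v * g' v))"
    by (intro sum.cong) (simp_all add: g ennreal_mult nn nonneg)
  also have "\<dots> = ennreal (\<Sum>v\<in>?V. jump_prob q u v * g' v)"
    by (intro sum_ennreal) (simp add: nn nonneg)
  also have "(\<Sum>v\<in>?V. jump_prob q u v * g' v) = (\<Sum>v\<in>?V. q u v * g' v) / exit_rate q u"
    by (simp add: jp sum_divide_distrib)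
  finally show ?thesis by (simp only: q_def sum_fcfs_rate)
qed

section \<open>The drift condition\<close>

text \<open>With \<open>r\<close> the exit rate and \<open>QW\<close> the rate-weighted sum of
  \<open>W\<close> over the successors, \<open>drift\<close> says
  \<open>QW s \<le> r * W u s - W' u s\<close>. Multiplied by \<open>exp (- r * s)\<close>, with
  time shifted by \<open>t\<close>, the right side is the derivative of
  \<open>- exp (- r * s) * W u (t + s)\<close>. The contribution of a jump before \<open>T\<close>
  is thus at most \<open>W u t - exp (- r * (T - t)) * W u T\<close>, and having no jump before
  \<open>T\<close> contributes exactly the missing term.\<close>

lemma jump_step_fcfs_le:
  fixes W W' :: "'k::finite list \<Rightarrow> real \<Rightarrow> real" and lam \<mu> :: "'k \<Rightarrow> real"
    and m :: "'k \<Rightarrow> nat" and n :: nat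
  defines "q \<equiv> fcfs_rate n lam m \<mu>"
  assumes lam: "\<And>i. 0 \<le> lam i" and \<mu>: "\<And>i. 0 \<le> \<mu> i"
    and served: "num_in_service n m u = length u"
    and W_nonneg: "\<And>v t. 0 \<le> t \<Longrightarrow> t \<le> T \<Longrightarrow> 0 \<le> W v t"
    and W_deriv: "\<And>v t. (W v has_real_derivative W' v t) (at t)"
    and W'_measurable: "\<And>v. W' v \<in> borel_measurable borel"
    and drift: "\<And>t. 0 \<le> t \<Longrightarrow> t \<le> T \<Longrightarrow>
      W' u t + (\<Sum>i\<in>UNIV. lam i * W (u @ [i]) t) + (\<Sum>j<length u. \<mu> (u ! j) * W (remove_nth j u) t)
        \<le> exit_rate q u * W u t"
    and r: "0 < exit_rate q u"
    and t: "0 \<le> t" "t \<le> T"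
  shows "(\<integral>\<^sup>+v. ennreal (jump_prob q u v) *
      (\<integral>\<^sup>+s. (if t + s \<le> T then ennreal (W v (t + s)) else ennreal (W u T))
        \<partial>density lborel (exponential_density (exit_rate q u))) \<partial>count_space UNIV)
    \<le> ennreal (W u t)"
proof -
  let ?r = "exit_rate q u"
  let ?D = "density lborel (exponential_density ?r)"
  define QW where "QW s = (\<Sum>i\<in>UNIV. lam i * W (u @ [i]) s) + (\<Sum>j<length u. \<mu> (u ! j) * W (remove_nth j u) s)" for s
  define f where "f v s = (if t + s \<le> T then ennreal (W v (t + s)) else ennreal (W u T))" for v s
  define b where "b = T - t"
  define G where "G s = exp (- ?r * s) * (?r * W u (t + s) - W' u (t + s))" for s
  have [measurable]: "W v \<in> borel_measurable borel" "W' v \<in> borel_measurable borel" for v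
    using W'_measurable
    by (auto intro!: borel_measurable_continuous_onI DERIV_continuous_on W_deriv)
  have [measurable]: "f v \<in> borel_measurable borel" for v
    unfolding f_def[abs_def] by measurable
  have [measurable]: "G \<in> borel_measurable borel"
    unfolding G_def[abs_def] by measurable
  have r_eq: "?r = (\<Sum>i\<in>UNIV. lam i) + (\<Sum>j<length u. \<mu> (u ! j))"
    by (simp add: q_def exit_rate_fcfs served)
  have QW_nonneg: "0 \<le> QW s" if "0 \<le> s" "s \<le> T" for s
    unfolding QW_def using that
    by (intro add_nonneg_nonneg sum_nonneg mult_nonneg_nonneg lam \<mu> W_nonneg)
  have jump: "(\<integral>\<^sup>+v. ennreal (jump_prob q u v) * f v s \<partial>count_space UNIV) =
      (if t + s \<le> T then ennreal (QW (t + s) / ?r) else ennreal (W u T))" if s: "0 \<le> s" for s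
  proof (cases "t + s \<le> T")
    case True
    have "(\<integral>\<^sup>+v. ennreal (jump_prob q u v) * f v s \<partial>count_space UNIV) = ennreal (((\<Sum>i\<in>UNIV. lam i * W (u @ [i]) (t + s)) +
      (\<Sum>j<num_in_service n m u. \<mu> (u ! j) * W (remove_nth j u) (t + s))) / exit_rate q u)"
      unfolding q_def
      by (rule nn_integral_jump_prob_fcfs)
         (use True s t r in \<open>auto simp: f_def lam \<mu> W_nonneg q_def\<close>)
    then show ?thesis using True by (simp add: QW_def served)
  next
    case False
    \<comment> \<open>After the cutoff the value no longer depends on the target \<open>v\<close>,
      so only the total jump probability 1 enters.\<close>
    have "(\<integral>\<^sup>+v. ennreal (jump_prob q u v) * f v s \<partial>count_space UNIV) = ennreal (((\<Sum>i\<in>UNIV. lam i * W u T) +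
      (\<Sum>j<num_in_service n m u. \<mu> (u ! j) * W u T)) / exit_rate q u)"
      unfolding q_def
      by (rule nn_integral_jump_prob_fcfs)
         (use False s t r in \<open>auto simp: f_def lam \<mu> W_nonneg q_def\<close>)
    also have "(\<Sum>i\<in>UNIV. lam i * W u T) + (\<Sum>j<num_in_service n m u. \<mu> (u ! j) * W u T) = ?r * W u T"
      by (simp add: r_eq served sum_distrib_right distrib_right)
    finally show ?thesis using False r by simp
  qed
  have b: "0 \<le> b" using t by (simp add: b_def)
  \<comment> \<open>\<open>G\<close> dominates \<open>exp (- ?r * s) * QW (t + s)\<close>, which is
    nonnegative. The sign is needed to integrate \<open>G\<close> in \<open>ennreal\<close> by the
    fundamental theorem.\<close>
  have G_nonneg: "0 \<le> G s" if "0 \<le> s" "s \<le> b" for s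
  proof -
    have ts: "0 \<le> t + s" "t + s \<le> T" using that t by (auto simp: b_def)
    show ?thesis using drift[OF ts] QW_nonneg[OF ts] by (simp add: G_def QW_def)
  qed
  have G_deriv: "((\<lambda>s. - exp (- ?r * s) * W u (t + s)) has_real_derivative G s) (at s)" for s
  proof -
    have "((\<lambda>s. W u (t + s)) has_real_derivative W' u (t + s)) (at s)"
      using DERIV_shift[of "W u" "W' u (t + s)" s t] W_deriv[of u "t + s"]
      by (simp add: add.commute)
    then have "((\<lambda>s. - exp (- ?r * s) * W u (t + s)) has_real_derivative
        - exp (- ?r * s) * W' u (t + s) + (?r * exp (- ?r * s)) * W u (t + s)) (at s)"
      by (auto intro!: derivative_eq_intros)
    moreover have "- exp (- ?r * s) * W' u (t + s) + (?r * exp (- ?r * s)) * W u (t + s) = G s"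
      by (simp add: G_def algebra_simps)
    ultimately show ?thesis by simp
  qed
  have "(\<integral>\<^sup>+v. ennreal (jump_prob q u v) * (\<integral>\<^sup>+s. f v s \<partial>?D) \<partial>count_space UNIV) =
      (\<integral>\<^sup>+v. \<integral>\<^sup>+s. ennreal (jump_prob q u v) * f v s \<partial>?D \<partial>count_space UNIV)"
    by (rule nn_integral_cong, rule nn_integral_cmult[symmetric]) simp
  also have "\<dots> = (\<integral>\<^sup>+s. \<integral>\<^sup>+v. ennreal (jump_prob q u v) * f v s \<partial>count_space UNIV \<partial>?D)"
    by (rule nn_integral_count_space_nn_integral[symmetric]) simp_all
  also have "\<dots> = (\<integral>\<^sup>+s. ennreal (exponential_density ?r s) *
      (\<integral>\<^sup>+v. ennreal (jump_prob q u v) * f v s \<partial>count_space UNIV) \<partial>lborel)"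
    by (rule nn_integral_density) (simp_all add: borel_measurable_nn_integral_countable)
  also have "\<dots> \<le> (\<integral>\<^sup>+s. ennreal (G s) * indicator {0..b} s +
      ennreal (W u T) * (ennreal (exponential_density ?r s) * indicator {b<..} s) \<partial>lborel)"
  proof (rule nn_integral_mono)
    fix s :: real
    show "ennreal (exponential_density ?r s) * (\<integral>\<^sup>+v. ennreal (jump_prob q u v) * f v s \<partial>count_space UNIV)
      \<le> ennreal (G s) * indicator {0..b} s +
      ennreal (W u T) * (ennreal (exponential_density ?r s) * indicator {b<..} s)"
    proof (cases "0 \<le> s")
      case True
      show ?thesis
      proof (cases "s \<le> b")
        case sb: True
        then have ts: "0 \<le> t + s" "t + s \<le> T" using True t by (auto simp: b_def)
        have "QW (t + s) \<le> ?r * W u (t + s) - W' u (t + s)"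
          using drift[OF ts] by (simp add: QW_def)
        then have "exponential_density ?r s * (QW (t + s) / ?r) \<le> G s"
          using True r by (simp add: exponential_density_def G_def mult.commute)
        then have "ennreal (exponential_density ?r s) * ennreal (QW (t + s) / ?r) \<le> ennreal (G s)"
          using True r QW_nonneg[OF ts]
          by (subst ennreal_mult[symmetric]) (auto intro: ennreal_leI exponential_density_nonneg)
        then show ?thesis using True sb ts by (simp add: jump)
      next
        case False
        then have "\<not> t + s \<le> T" by (simp add: b_def)
        then show ?thesis using True False by (simp add: jump) (simp add: mult.commute)
      qed
    qed (simp add: exponential_density_def)
  qed
  also have "\<dots> = (\<integral>\<^sup>+s. ennreal (G s) * indicator {0..b} s \<partial>lborel) +
      ennreal (W u T) * (\<integral>\<^sup>+s. ennreal (exponential_density ?r s) * indicator {b<..} s \<partial>lborel)"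
    by (subst nn_integral_add) (simp_all add: nn_integral_cmult)
  also have "(\<integral>\<^sup>+s. ennreal (exponential_density ?r s) * indicator {b<..} s \<partial>lborel) = ennreal (exp (- ?r * b))"
    using emeasure_exponential_greaterThan[OF r, of b] t by (simp add: emeasure_density b_def)
  also have "(\<integral>\<^sup>+s. ennreal (G s) * indicator {0..b} s \<partial>lborel) =
      ennreal ((- exp (- ?r * b) * W u (t + b)) - (- exp (- ?r * 0) * W u (t + 0)))"
    by (rule nn_integral_FTC_Icc) (use G_nonneg G_deriv b in auto)
  also have "ennreal ((- exp (- ?r * b) * W u (t + b)) - (- exp (- ?r * 0) * W u (t + 0))) +
      ennreal (W u T) * ennreal (exp (- ?r * b)) = ennreal (W u t)"
  proof -
    have W_T: "0 \<le> W u T" using t by (intro W_nonneg) auto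
    have "0 \<le> (- exp (- ?r * b) * W u (t + b)) - (- exp (- ?r * 0) * W u (t + 0))"
      using DERIV_nonneg_imp_nondecreasing[OF b, of "\<lambda>s. - exp (- ?r * s) * W u (t + s)"] G_nonneg G_deriv
      by force
    then show ?thesis using W_T
      by (simp add: ennreal_mult[symmetric] ennreal_plus[symmetric] b_def mult.commute del: ennreal_plus)
  qed
  finally show ?thesis by (simp add: f_def)
qed

section \<open>Drift of the quadratic Lyapunov function\<close>

lemma sum_eq_except:
  fixes f g :: "'k::finite \<Rightarrow> real"
  assumes "\<And>i. i \<noteq> l \<Longrightarrow> f i = g i"
  shows "sum f UNIV = sum g UNIV + (f l - g l)"
  using assms by (simp add: sum.remove[of UNIV l])

text \<open>The squared scaled deviation has drift at most of order \<open>1 / lam i\<close>, which the linearly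
  decreasing term compensates.\<close>

definition lyapunov ::
  "('k::finite \<Rightarrow> real) \<Rightarrow> ('k \<Rightarrow> real \<Rightarrow> real) \<Rightarrow> ('k \<Rightarrow> real) \<Rightarrow> real \<Rightarrow> 'k list \<Rightarrow> real \<Rightarrow> real" where
  "lyapunov lam x \<beta> T u t = (\<Sum>i\<in>UNIV. (real (count_list u i) / lam i - x i t)\<^sup>2 + \<beta> i * (T - t))"

text \<open>With \<open>e\<close> the scaled deviation, an arrival changes its square by
  \<open>2 * e / lam + 1 / lam^2\<close> and a departure by
  \<open>- 2 * e / lam + 1 / lam^2\<close>. When all jobs are served, departures occur at rate
  \<open>\<mu> * lam * (e + x)\<close>, and together with the time derivative
  \<open>- 2 * e * (1 - \<mu> * x)\<close> the linear terms cancel up to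
  \<open>- 2 * \<mu> * e^2 + \<mu> * e / lam\<close>. What remains is bounded by
  \<open>(1 + \<mu> * x) / lam + \<mu> / lam^2\<close>, the quantity that \<open>\<beta>\<close> has
  to dominate.\<close>

lemma lyapunov_drift:
  fixes lam \<mu> \<beta> :: "'k::finite \<Rightarrow> real" and x :: "'k \<Rightarrow> real \<Rightarrow> real" and T :: real
  assumes lam: "\<And>i. 0 < lam i" and \<mu>: "\<And>i. 0 < \<mu> i"
    and \<beta>: "\<And>i. (1 + \<mu> i * x i t) / lam i + \<mu> i / (lam i)\<^sup>2 \<le> \<beta> i"
  defines "W \<equiv> lyapunov lam x \<beta> T"
  shows "(\<Sum>i\<in>UNIV. - 2 * (real (count_list u i) / lam i - x i t) * (1 - \<mu> i * x i t) - \<beta> i) +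
      (\<Sum>i\<in>UNIV. lam i * W (u @ [i]) t) + (\<Sum>j<length u. \<mu> (u ! j) * W (remove_nth j u) t)
    \<le> ((\<Sum>i\<in>UNIV. lam i) + (\<Sum>j<length u. \<mu> (u ! j))) * W u t"
proof -
  define e where "e i = real (count_list u i) / lam i - x i t" for i
  have append: "W (u @ [l]) t = W u t + (2 * e l / lam l + 1 / (lam l)\<^sup>2)" for l
    unfolding W_def lyapunov_def
    by (subst sum_eq_except[where l = l and g = "\<lambda>i. (real (count_list u i) / lam i - x i t)\<^sup>2 + \<beta> i * (T - t)"])
       (use lam[of l] in \<open>simp_all add: e_def field_simps power2_eq_square\<close>)
  have remove: "W (remove_nth j u) t = W u t + (- 2 * e (u ! j) / lam (u ! j) + 1 / (lam (u ! j))\<^sup>2)"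
    if j: "j < length u" for j
  proof -
    \<comment> \<open>The departing job is itself counted, so the truncated subtraction on naturals
      is a true one.\<close>
    have "count_list u (u ! j) \<noteq> 0" using j by (simp add: count_list_0_iff)
    then have *: "real (count_list u (u ! j) - 1) = real (count_list u (u ! j)) - 1" by simp
    show ?thesis
      unfolding W_def lyapunov_def
      by (subst sum_eq_except[where l = "u ! j" and g = "\<lambda>i. (real (count_list u i) / lam i - x i t)\<^sup>2 + \<beta> i * (T - t)"])
         (use lam[of "u ! j"] * in \<open>simp_all add: count_list_remove_nth[OF j] e_def field_simps power2_eq_square\<close>)
  qed
  have "(\<Sum>i\<in>UNIV. lam i * W (u @ [i]) t) = (\<Sum>i\<in>UNIV. lam i) * W u t + (\<Sum>i\<in>UNIV. 2 * e i + 1 / lam i)"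
    unfolding append
    by (subst sum_distrib_right, subst sum.distrib[symmetric], rule sum.cong)
       (use lam in \<open>simp_all add: field_simps power2_eq_square less_imp_neq[symmetric]\<close>)
  moreover have "(\<Sum>j<length u. \<mu> (u ! j) * W (remove_nth j u) t) =
      (\<Sum>j<length u. \<mu> (u ! j)) * W u t +
      (\<Sum>j<length u. \<mu> (u ! j) * (- 2 * e (u ! j) / lam (u ! j) + 1 / (lam (u ! j))\<^sup>2))"
    by (subst sum_distrib_right, subst sum.distrib[symmetric], rule sum.cong)
       (simp_all add: remove algebra_simps)
  moreover have "(\<Sum>j<length u. \<mu> (u ! j) * (- 2 * e (u ! j) / lam (u ! j) + 1 / (lam (u ! j))\<^sup>2)) =
      (\<Sum>i\<in>UNIV. real (count_list u i) * (\<mu> i * (- 2 * e i / lam i + 1 / (lam i)\<^sup>2)))"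
    by (rule sum_nth_count_list[where g = "\<lambda>i. \<mu> i * (- 2 * e i / lam i + 1 / (lam i)\<^sup>2)"])
  moreover have "(\<Sum>i\<in>UNIV. - 2 * e i * (1 - \<mu> i * x i t) - \<beta> i) + (\<Sum>i\<in>UNIV. 2 * e i + 1 / lam i) +
      (\<Sum>i\<in>UNIV. real (count_list u i) * (\<mu> i * (- 2 * e i / lam i + 1 / (lam i)\<^sup>2))) \<le> 0"
  proof -
    have "- 2 * e i * (1 - \<mu> i * x i t) - \<beta> i + (2 * e i + 1 / lam i) +
       real (count_list u i) * (\<mu> i * (- 2 * e i / lam i + 1 / (lam i)\<^sup>2)) \<le> 0" for i
    proof -
      have c: "real (count_list u i) = lam i * (e i + x i t)"
        using lam[of i] by (simp add: e_def)
      have "- 2 * e i * (1 - \<mu> i * x i t) + (2 * e i + 1 / lam i) +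
         real (count_list u i) * (\<mu> i * (- 2 * e i / lam i + 1 / (lam i)\<^sup>2)) =
         1 / lam i + \<mu> i * x i t / lam i + \<mu> i * (e i * (1 / lam i) - 2 * (e i)\<^sup>2)"
        unfolding c using lam[of i] by (simp add: field_simps power2_eq_square)
      also have "\<mu> i * (e i * (1 / lam i) - 2 * (e i)\<^sup>2) \<le> \<mu> i * (1 / lam i)\<^sup>2"
      proof (rule mult_left_mono)
        \<comment> \<open>The mixed term is absorbed by the restoring term: \<open>e * l\<close> is
          at most half of \<open>e^2 + l^2\<close>, with \<open>l = 1 / lam i\<close>.\<close>
        have "0 \<le> (e i - (1 / lam i))\<^sup>2" "0 \<le> (e i)\<^sup>2" "0 \<le> (1 / lam i)\<^sup>2" by simp_all
        then show "e i * (1 / lam i) - 2 * (e i)\<^sup>2 \<le> (1 / lam i)\<^sup>2"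
          by (simp only: power2_diff)
      qed (use \<mu>[of i] in simp)
      finally show ?thesis using \<beta>[of i] by (simp add: power_divide add_divide_distrib)
    qed
    then have "(\<Sum>i\<in>UNIV. - 2 * e i * (1 - \<mu> i * x i t) - \<beta> i + (2 * e i + 1 / lam i) +
       real (count_list u i) * (\<mu> i * (- 2 * e i / lam i + 1 / (lam i)\<^sup>2))) \<le> 0"
      by (intro sum_nonpos)
    then show ?thesis by (simp only: sum.distrib)
  qed
  ultimately show ?thesis by (simp add: e_def distrib_right)
qed

lemma lyapunov_has_derivative:
  assumes "\<And>i. (x i has_real_derivative 1 - \<mu> i * x i t) (at t)"
  shows "(lyapunov lam x \<beta> T u has_real_derivative
    (\<Sum>i\<in>UNIV. - 2 * (real (count_list u i) / lam i - x i t) * (1 - \<mu> i * x i t) - \<beta> i)) (at t)"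
  unfolding lyapunov_def[abs_def]
  by (rule DERIV_sum) (auto intro!: derivative_eq_intros assms simp: algebra_simps add_divide_distrib diff_divide_distrib)

section \<open>Sample paths\<close>

context jump_chain begin

text \<open>\<open>is_ctmc\<close> restricts the transitions only in law; impossible ones may occur
  on a null set, a countable union over \<open>k\<close>, \<open>u\<close> and \<open>v\<close>.
  Excluding it is what permits the bound of one job per jump on individual paths.\<close>

lemma AE_jump_prob_nonzero: "AE \<omega> in M. \<forall>k. jump_prob q (Z k \<omega>) (Z (Suc k) \<omega>) \<noteq> 0"
proof (subst AE_all_countable, rule allI)
  fix k
  have "AE \<omega> in M. \<not> (jump_prob q u v = 0 \<and> Z k \<omega> = u \<and> Z (Suc k) \<omega> = v)" for u v
  proof (cases "jump_prob q u v = 0")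
    case True
    have "space M \<in> sets (past k)" using sets.top[of "past k"] by simp
    from emeasure_step[OF this order.refl, of u v] True
    have "emeasure M (space M \<inter> {\<omega>\<in>space M. Z k \<omega> = u \<and> 0 < S k \<omega> \<and> Z (Suc k) \<omega> = v}) = 0"
      by simp
    also have "space M \<inter> {\<omega>\<in>space M. Z k \<omega> = u \<and> 0 < S k \<omega> \<and> Z (Suc k) \<omega> = v} =
        {\<omega>\<in>space M. \<not> \<not> (jump_prob q u v = 0 \<and> Z k \<omega> = u \<and> Z (Suc k) \<omega> = v)}"
      using S_pos True by auto
    finally show ?thesis by (subst AE_iff_measurable[OF _ refl]) auto
  qed simp
  then have "AE \<omega> in M. \<forall>u v. \<not> (jump_prob q u v = 0 \<and> Z k \<omega> = u \<and> Z (Suc k) \<omega> = v)"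
    by (subst AE_all_countable, intro allI, subst AE_all_countable, intro allI)
  then show "AE \<omega> in M. jump_prob q (Z k \<omega>) (Z (Suc k) \<omega>) \<noteq> 0" by eventually_elim auto
qed

end

locale jump_path = jump_chain +
  fixes U :: "real \<Rightarrow> 'a \<Rightarrow> 'b"
  assumes path: "\<And>\<omega> t. \<omega> \<in> space M \<Longrightarrow> 0 \<le> t \<Longrightarrow>
    \<exists>k. jump_time k \<omega> \<le> t \<and> t < jump_time (Suc k) \<omega> \<and> U t \<omega> = Z k \<omega>"
begin

text \<open>\<open>path\<close> only provides some index; the sojourn intervals are disjoint, so it
  is the given \<open>k\<close>.\<close>

lemma path_eq:
  assumes \<omega>: "\<omega> \<in> space M" and k: "jump_time k \<omega> \<le> t" "t < jump_time (Suc k) \<omega>"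
  shows "U t \<omega> = Z k \<omega>"
proof -
  have "0 \<le> t" using jump_time_nonneg[OF \<omega>, of k] k by simp
  then obtain l where l: "jump_time l \<omega> \<le> t" "t < jump_time (Suc l) \<omega>" "U t \<omega> = Z l \<omega>"
    using path[OF \<omega>] by blast
  have "\<not> l < k" using jump_time_mono[OF \<omega>, of "Suc l" k] k l by auto
  moreover have "\<not> k < l" using jump_time_mono[OF \<omega>, of "Suc k" l] k l by auto
  ultimately show ?thesis using l by (simp add: nat_neq_iff[of k l] not_less_iff_gr_or_eq)
qed

lemma path_0: "\<omega> \<in> space M \<Longrightarrow> U 0 \<omega> = Z 0 \<omega>"
  using S_pos[of \<omega> 0] by (intro path_eq) (auto simp: jump_time_Suc)

lemma path_measurable:
  assumes "0 \<le> t"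
  shows "U t \<in> measurable M (count_space UNIV)"
proof (subst measurable_count_space_eq2_countable, intro conjI ballI)
  fix u
  have "U t -` {u} \<inter> space M =
      (\<Union>k. {\<omega>\<in>space M. jump_time k \<omega> \<le> t \<and> t < jump_time (Suc k) \<omega> \<and> Z k \<omega> = u})"
    using path[OF _ assms] by (auto dest: path_eq) metis
  also have "\<dots> \<in> sets M" by measurable
  finally show "U t -` {u} \<inter> space M \<in> sets M" .
qed auto

context
  fixes g :: "'b \<Rightarrow> real \<Rightarrow> real" and T :: real
  assumes g: "\<And>u. continuous_on UNIV (g u)" and T: "0 \<le> T"
begin

text \<open>Up to \<open>T\<close> the path has finitely many sojourns, and \<open>g\<close> is
  continuous on a compact interval in each of the states. Without boundedness a real supremum would
  carry no information.\<close>

lemma bdd_above_path: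
  assumes \<omega>: "\<omega> \<in> space M"
  shows "bdd_above ((\<lambda>t. g (U t \<omega>) t) ` {0..T})"
proof -
  obtain N where N: "T < jump_time (Suc N) \<omega>" using path[OF \<omega> T] by blast
  have "compact (g (Z k \<omega>) ` {0..T})" for k
    by (rule compact_continuous_image[OF continuous_on_subset[OF g]]) auto
  then have "bdd_above (g (Z k \<omega>) ` {0..T})" for k
    by (intro bounded_imp_bdd_above compact_imp_bounded)
  then have "bdd_above (\<Union>k\<in>{..N}. g (Z k \<omega>) ` {0..T})"
    by (subst bdd_above_UN) auto
  moreover have "(\<lambda>t. g (U t \<omega>) t) ` {0..T} \<subseteq> (\<Union>k\<in>{..N}. g (Z k \<omega>) ` {0..T})"
  proof (rule image_subsetI)
    fix t assume t: "t \<in> {0..T}"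
    then obtain k where k: "jump_time k \<omega> \<le> t" "U t \<omega> = Z k \<omega>" using path[OF \<omega>, of t] by auto
    have "k \<le> N"
    proof (rule ccontr)
      assume "\<not> k \<le> N"
      then show False using jump_time_mono[OF \<omega>, of "Suc N" k] N k t by auto
    qed
    then show "g (U t \<omega>) t \<in> (\<Union>k\<in>{..N}. g (Z k \<omega>) ` {0..T})"
      unfolding k(2) using t by blast
  qed
  ultimately show ?thesis by (rule bdd_above_mono)
qed

text \<open>Right-continuity reduces the uncountable supremum to a countable one: a value above the
  countable supremum at \<open>t < T\<close> would persist on a short interval to the right, inside
  the same sojourn, and this interval contains a rational.\<close>

lemma Sup_path_measurable:
  "(\<lambda>\<omega>. SUP t\<in>{0..T}. g (U t \<omega>) t) \<in> borel_measurable M"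
proof -
  \<comment> \<open>\<open>T\<close> is added because it cannot be approached from the right within
    \<open>{0..T}\<close>.\<close>
  let ?D = "insert T ({0..T} \<inter> \<rat>)"
  have D_sub: "?D \<subseteq> {0..T}" using T by auto
  have "(\<lambda>\<omega>. SUP t\<in>?D. g (U t \<omega>) t) \<in> borel_measurable M"
  proof (rule borel_measurable_cSUP)
    show "countable ?D" by (intro countable_insert countable_Int2 countable_rat)
    show "(\<lambda>\<omega>. g (U t \<omega>) t) \<in> borel_measurable M" if "t \<in> ?D" for t
      using measurable_compose[OF path_measurable borel_measurable_count_space, of t "\<lambda>u. g u t"] that D_sub
      by auto
    show "bdd_above ((\<lambda>t. g (U t \<omega>) t) ` ?D)" if "\<omega> \<in> space M" for \<omega>
      using bdd_above_path[OF that] D_sub by (meson bdd_above_mono image_mono)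
  qed
  moreover have "(SUP t\<in>{0..T}. g (U t \<omega>) t) = (SUP t\<in>?D. g (U t \<omega>) t)" if \<omega>: "\<omega> \<in> space M" for \<omega>
  proof (rule antisym)
    let ?c = "SUP t\<in>?D. g (U t \<omega>) t"
    have bdd: "bdd_above ((\<lambda>t. g (U t \<omega>) t) ` ?D)"
      using bdd_above_path[OF \<omega>] D_sub by (meson bdd_above_mono image_mono)
    show "?c \<le> (SUP t\<in>{0..T}. g (U t \<omega>) t)"
      by (rule cSUP_subset_mono[OF _ bdd_above_path[OF \<omega>] D_sub]) auto
    show "(SUP t\<in>{0..T}. g (U t \<omega>) t) \<le> ?c"
    proof (rule cSUP_least)
      fix t assume t: "t \<in> {0..T}"
      show "g (U t \<omega>) t \<le> ?c"
      proof (cases "t = T")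
        case True
        then show ?thesis by (intro cSUP_upper[OF _ bdd]) auto
      next
        case False
        obtain k where k: "jump_time k \<omega> \<le> t" "t < jump_time (Suc k) \<omega>" "U t \<omega> = Z k \<omega>"
          using path[OF \<omega>, of t] t by auto
        show ?thesis
        proof (rule ccontr)
          assume "\<not> g (U t \<omega>) t \<le> ?c"
          then have "?c < g (Z k \<omega>) t" using k by simp
          moreover have "g (Z k \<omega>) \<midarrow>t\<rightarrow> g (Z k \<omega>) t"
            using g[of "Z k \<omega>"] by (simp add: continuous_on_def)
          ultimately have "\<forall>\<^sub>F s in at t. ?c < g (Z k \<omega>) s"
            by (rule order_tendstoD(1)[rotated])
          then obtain d where d: "0 < d" "\<And>s. s \<noteq> t \<Longrightarrow> dist s t < d \<Longrightarrow> ?c < g (Z k \<omega>) s"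
            unfolding eventually_at by auto
          have "t < min (t + d) (min T (jump_time (Suc k) \<omega>))" using d k t False by auto
          from Rats_dense_in_real[OF this] obtain s where
            s: "s \<in> \<rat>" "t < s" "s < t + d" "s < T" "s < jump_time (Suc k) \<omega>" by auto
          have "g (U s \<omega>) s \<le> ?c"
            by (rule cSUP_upper[OF _ bdd]) (use s t in auto)
          moreover have "U s \<omega> = Z k \<omega>" using k s by (intro path_eq[OF \<omega>]) auto
          moreover have "?c < g (Z k \<omega>) s" using s d(2)[of s] by (simp add: dist_real_def)
          ultimately show False by simp
        qed
      qed
    qed (use T in auto)
  qed
  ultimately show ?thesis by (simp cong: measurable_cong)
qed

end

end

lemma is_ctmc_jump_path:
  fixes q :: "'s::countable \<Rightarrow> 's \<Rightarrow> real"
  assumes "is_ctmc M q U" "\<And>u v. 0 \<le> q u v" "\<And>u. 0 < exit_rate q u"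
  obtains Z S where "jump_path M q Z S U"
proof -
  from assms(1) obtain Z S where M: "prob_space M"
    and meas: "\<forall>k. Z k \<in> measurable M (count_space UNIV)" "\<forall>k. S k \<in> borel_measurable M"
    and paths: "\<forall>\<omega>\<in>space M. (\<forall>k. 0 < S k \<omega>) \<and>
      (\<forall>t\<ge>0. \<exists>k. (\<Sum>j<k. S j \<omega>) \<le> t \<and> t < (\<Sum>j<Suc k. S j \<omega>) \<and> U t \<omega> = Z k \<omega>)"
    and law: "\<forall>k (z :: nat \<Rightarrow> 's) (s :: nat \<Rightarrow> real). (\<forall>j. 0 \<le> s j) \<longrightarrow>
       measure M {\<omega>\<in>space M. (\<forall>j\<le>k. Z j \<omega> = z j) \<and> (\<forall>j<k. s j < S j \<omega>)} =
       measure M {\<omega>\<in>space M. Z 0 \<omega> = z 0} *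
         (\<Prod>j<k. exp (- exit_rate q (z j) * s j) * jump_prob q (z j) (z (Suc j)))"
    unfolding is_ctmc_def by blast
  interpret prob_space M by (rule M)
  interpret jump_chain M q Z S
    by unfold_locales (use meas paths law assms(2,3) in blast)+
  have "jump_path M q Z S U"
  proof unfold_locales
    show "\<exists>k. jump_time k \<omega> \<le> t \<and> t < jump_time (Suc k) \<omega> \<and> U t \<omega> = Z k \<omega>"
      if "\<omega> \<in> space M" "0 \<le> t" for \<omega> t
      using paths that unfolding jump_time_def by blast
  qed
  then show ?thesis by (rule that)
qed

section \<open>The fluid limit\<close>

text \<open>The solution of \<open>y' = 1 - \<mu> * y\<close> started at \<open>a\<close>, that is
  the fluid equation of an infinite-server queue, relaxing to \<open>1 / \<mu>\<close>.\<close>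

definition fluid :: "real \<Rightarrow> real \<Rightarrow> real \<Rightarrow> real" where
  "fluid \<mu> a t = 1 / \<mu> + (a - 1 / \<mu>) * exp (- \<mu> * t)"

lemma fluid_0 [simp]: "fluid \<mu> a 0 = a"
  by (simp add: fluid_def)

lemma fluid_has_derivative:
  "0 < \<mu> \<Longrightarrow> (fluid \<mu> a has_real_derivative 1 - \<mu> * fluid \<mu> a t) (at t within A)"
  unfolding fluid_def[abs_def] by (auto intro!: derivative_eq_intros simp: field_simps)

lemma fluid_le:
  assumes "0 < \<mu>" "0 \<le> t"
  shows "\<mu> * fluid \<mu> a t \<le> max (\<mu> * a) 1"
proof -
  let ?e = "exp (- \<mu> * t)"
  have e: "0 \<le> ?e" "?e \<le> 1" using assms by auto
  have "\<mu> * fluid \<mu> a t = ?e * (\<mu> * a) + (1 - ?e) * 1"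
    using assms by (simp add: fluid_def field_simps)
  also have "\<dots> \<le> max (\<mu> * a) 1"
    using e by (intro convex_bound_le) auto
  finally show ?thesis .
qed

text \<open>\<open>fluid\<close> is monotone in time, increasing or decreasing according to the side
  of \<open>1 / \<mu>\<close> on which \<open>a\<close> lies, so its distance to a fixed number is
  largest at an end point. During a sojourn the scaled count is such a fixed number.\<close>

lemma abs_diff_fluid_le:
  assumes "0 < \<mu>" "s \<le> t" "t \<le> r"
  shows "\<bar>x - fluid \<mu> a t\<bar> \<le> max \<bar>x - fluid \<mu> a s\<bar> \<bar>x - fluid \<mu> a r\<bar>"
proof -
  have e: "exp (- \<mu> * r) \<le> exp (- \<mu> * t)" "exp (- \<mu> * t) \<le> exp (- \<mu> * s)"
    using assms by auto
  show ?thesis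
  proof (cases "a \<le> 1 / \<mu>")
    case True
    with e have "fluid \<mu> a s \<le> fluid \<mu> a t" "fluid \<mu> a t \<le> fluid \<mu> a r"
      unfolding fluid_def by (auto intro!: mult_left_mono_neg)
    then show ?thesis by (auto simp: abs_if max_def)
  next
    case False
    with e have "fluid \<mu> a t \<le> fluid \<mu> a s" "fluid \<mu> a r \<le> fluid \<mu> a t"
      unfolding fluid_def by (auto intro!: mult_left_mono)
    then show ?thesis by (auto simp: abs_if max_def)
  qed
qed

text \<open>The right-hand side of the equation decreases in \<open>y\<close>, so the squared distance of two
  solutions is nonincreasing.\<close>

lemma ode_eq_fluid:
  fixes y :: "real \<Rightarrow> real"
  assumes \<mu>: "0 < \<mu>"
    and y: "\<And>t. 0 \<le> t \<Longrightarrow> (y has_real_derivative 1 - min (\<mu> * y t) c) (at t within {0..})"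
    and c: "\<mu> * y 0 \<le> c" "1 \<le> c" and t: "0 \<le> t"
  shows "y t = fluid \<mu> (y 0) t"
proof -
  let ?x = "fluid \<mu> (y 0)"
  \<comment> \<open>Below the cap \<open>c\<close> the minimum does nothing to \<open>?x\<close>, so
    \<open>?x\<close> solves the same equation as \<open>y\<close>. The two factors of
    \<open>g'\<close> then have opposite signs.\<close>
  define g' where "g' s = 2 * (y s - ?x s) * (min (\<mu> * ?x s) c - min (\<mu> * y s) c)" for s
  have x_le: "\<mu> * ?x s \<le> c" if "0 \<le> s" for s
    using fluid_le[OF \<mu> that, of "y 0"] c by simp
  have deriv: "((\<lambda>s. (y s - ?x s)\<^sup>2) has_real_derivative g' s) (at s within {0..})" if "0 \<le> s" for s
    using x_le[OF that] that
    by (auto intro!: derivative_eq_intros y fluid_has_derivative \<mu> simp: g'_def min_def algebra_simps)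
  have g'_le: "g' s \<le> 0" for s
  proof (cases "y s \<le> ?x s")
    case True
    then have "min (\<mu> * y s) c \<le> min (\<mu> * ?x s) c" using \<mu> by (intro min.mono) auto
    then show ?thesis using True by (simp add: g'_def mult_nonpos_nonneg)
  next
    case False
    then have "min (\<mu> * ?x s) c \<le> min (\<mu> * y s) c" using \<mu> by (intro min.mono) auto
    then show ?thesis using False by (simp add: g'_def mult_nonneg_nonpos)
  qed
  have "(y t - ?x t)\<^sup>2 \<le> (y 0 - ?x 0)\<^sup>2"
  proof (cases "t = 0")
    case False
    show ?thesis
    proof (rule DERIV_nonpos_imp_decreasing_open[of 0 t "\<lambda>s. (y s - ?x s)\<^sup>2"])
      fix s :: real assume s: "0 < s" "s < t"
      then have "at s within {0..} = at s" by (intro at_within_interior) simp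
      then show "\<exists>d. ((\<lambda>s. (y s - ?x s)\<^sup>2) has_real_derivative d) (at s) \<and> d \<le> 0"
        using deriv[of s] g'_le[of s] s by auto
    next
      have "continuous_on {0..} (\<lambda>s. (y s - ?x s)\<^sup>2)"
        by (rule DERIV_continuous_on[OF deriv]) simp
      then show "continuous_on {0..t} (\<lambda>s. (y s - ?x s)\<^sup>2)"
        by (rule continuous_on_subset) auto
    qed (use t in simp)
  qed simp
  then show ?thesis by simp
qed

section \<open>Deviation from the fluid limit\<close>

lemma fcfs_jump_count_diff:
  assumes "jump_prob (fcfs_rate n lam m \<mu>) u v \<noteq> 0"
  shows "\<bar>real (count_list v i) - real (count_list u i)\<bar> \<le> 1"
proof -
  have "v \<in> fcfs_succ n m u"
    using assms fcfs_rate_outside[of v n m u lam \<mu>] by (auto simp: jump_prob_def split: if_splits)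
  then consider l where "v = u @ [l]" | j where "j < length u" "v = remove_nth j u"
    using num_in_service_le[of n m u] unfolding fcfs_succ_def
    by (metis (no_types, lifting) UnE imageE lessThan_iff less_le_trans)
  then show ?thesis
  proof cases
    case 1
    then show ?thesis by simp
  next
    case 2
    then show ?thesis by (cases "count_list u i") (simp_all add: count_list_remove_nth)
  qed
qed

lemma lyapunov_less_imp:
  assumes "lyapunov lam x \<beta> T u t < \<sigma>\<^sup>2" "0 \<le> \<sigma>" "t \<le> T" "\<And>i. 0 \<le> \<beta> i"
  shows "\<bar>real (count_list u i) / lam i - x i t\<bar> < \<sigma>"
proof -
  have "(real (count_list u i) / lam i - x i t)\<^sup>2 \<le> (real (count_list u i) / lam i - x i t)\<^sup>2 + \<beta> i * (T - t)"
    using assms by simp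
  also have "\<dots> \<le> lyapunov lam x \<beta> T u t"
    unfolding lyapunov_def using assms
    by (intro member_le_sum[where f = "\<lambda>i. (real (count_list u i) / lam i - x i t)\<^sup>2 + \<beta> i * (T - t)"]) auto
  also note assms(1)
  finally have "\<bar>real (count_list u i) / lam i - x i t\<bar>\<^sup>2 < \<sigma>\<^sup>2" by simp
  then show ?thesis using assms(2) by (rule power2_less_imp_less)
qed

text \<open>Either the initial Lyapunov value is above \<open>\<eta>\<close>, or the maximal
  inequality at level \<open>\<sigma>\<^sup>2\<close> applies. \<open>served\<close> makes the drift
  estimate available below this level. The event \<open>X\<close> is stated with
  \<open>\<sigma> + 1 / lam i\<close> because the end of a sojourn is controlled only through the
  state after the jump, which differs by one job.\<close>

lemma fcfs_deviation_bound:
  fixes lam \<mu> a :: "'k::finite \<Rightarrow> real" and m :: "'k \<Rightarrow> nat" and U :: "real \<Rightarrow> 'w \<Rightarrow> 'k list"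
    and T \<sigma> \<eta> :: real
  defines "x \<equiv> \<lambda>i. fluid (\<mu> i) (a i)"
  assumes chain: "is_ctmc M (fcfs_rate n lam m \<mu>) U"
    and lam: "\<And>i. 0 < lam i" and \<mu>: "\<And>i. 0 < \<mu> i"
    and served: "\<And>u t. 0 \<le> t \<Longrightarrow> t \<le> T \<Longrightarrow>
      (\<And>i. \<bar>real (count_list u i) / lam i - x i t\<bar> < \<sigma>) \<Longrightarrow> (\<Sum>i\<in>UNIV. count_list u i * m i) \<le> n"
    and \<beta>: "\<And>i t. 0 \<le> t \<Longrightarrow> (1 + \<mu> i * x i t) / lam i + \<mu> i / (lam i)\<^sup>2 \<le> \<beta> i"
    and \<beta>_nonneg: "\<And>i. 0 \<le> \<beta> i"
    and T: "0 \<le> T" and \<sigma>: "0 < \<sigma>" and \<eta>: "0 \<le> \<eta>" "\<eta> < \<sigma>\<^sup>2"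
    and X: "\<And>\<omega>. \<omega> \<in> X \<Longrightarrow>
      \<exists>t\<in>{0..T}. \<exists>i. \<sigma> + 1 / lam i \<le> \<bar>real (count_list (U t \<omega>) i) / lam i - x i t\<bar>"
  shows "measure M X \<le> measure M {\<omega>\<in>space M. \<eta> < lyapunov lam x \<beta> T (U 0 \<omega>) 0} + \<eta> / \<sigma>\<^sup>2"
proof -
  let ?q = "fcfs_rate n lam m \<mu>"
  define W where "W = lyapunov lam x \<beta> T"
  have exit_pos: "0 < exit_rate ?q u" for u
    unfolding exit_rate_fcfs
    by (intro add_pos_nonneg sum_pos sum_nonneg lam less_imp_le[OF \<mu>]) auto
  obtain Z S where "jump_path M ?q Z S U"
    by (rule is_ctmc_jump_path[OF chain fcfs_rate_nonneg[OF less_imp_le[OF lam] less_imp_le[OF \<mu>]] exit_pos])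
  then interpret jump_path M ?q Z S U .
  define W' where "W' u t = (\<Sum>i\<in>UNIV. - 2 * (real (count_list u i) / lam i - x i t) * (1 - \<mu> i * x i t) - \<beta> i)"
    for u t
  have W_deriv: "(W u has_real_derivative W' u t) (at t)" for u t
    unfolding W_def W'_def by (rule lyapunov_has_derivative) (simp add: x_def fluid_has_derivative \<mu>)
  have x_cont: "continuous_on UNIV (x i)" for i
    unfolding x_def by (rule DERIV_continuous_on) (rule fluid_has_derivative[OF \<mu>])
  have [measurable]: "x i \<in> borel_measurable borel" for i
    by (rule borel_measurable_continuous_onI[OF x_cont])
  have [measurable]: "W u \<in> borel_measurable borel" "W' u \<in> borel_measurable borel" for u
    unfolding W_def lyapunov_def[abs_def] W'_def[abs_def] by measurable
  have W_nonneg: "0 \<le> W u t" if "t \<le> T" for u t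
    unfolding W_def lyapunov_def using that \<beta>_nonneg by (intro sum_nonneg) auto
  have dev: "\<bar>real (count_list u i) / lam i - x i t\<bar> < \<sigma>" if "W u t < \<sigma>\<^sup>2" "t \<le> T" for u i t
    using that \<sigma> \<beta>_nonneg unfolding W_def by (intro lyapunov_less_imp) auto
  have maximal: "prob {\<omega>\<in>space M. W (Z 0 \<omega>) 0 \<le> \<eta> \<and> (\<exists>k. exceeds W T (\<sigma>\<^sup>2) k \<omega>)} \<le> \<eta> / \<sigma>\<^sup>2"
  proof (rule maximal_inequality)
    fix u t assume t: "0 \<le> t" "t \<le> T" and u: "W u t < \<sigma>\<^sup>2"
    \<comment> \<open>A Lyapunov value below \<open>\<sigma>\<^sup>2\<close> puts every class within
      \<open>\<sigma>\<close> of the fluid solution, where \<open>served\<close> says that nobody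
      waits.\<close>
    have "num_in_service n m u = length u"
      by (rule num_in_service_all[OF served[OF t]]) (rule dev[OF u t(2)])
    note served_u = this
    show "(\<integral>\<^sup>+v. ennreal (jump_prob ?q u v) *
        (\<integral>\<^sup>+s. (if t + s \<le> T then ennreal (W v (t + s)) else ennreal (W u T))
          \<partial>density lborel (exponential_density (exit_rate ?q u))) \<partial>count_space UNIV)
      \<le> ennreal (W u t)"
    proof (rule jump_step_fcfs_le[where W' = W', OF _ _ served_u])
      fix s assume s: "0 \<le> s" "s \<le> T"
      have "exit_rate ?q u = (\<Sum>i\<in>UNIV. lam i) + (\<Sum>j<length u. \<mu> (u ! j))"
        using served_u by (simp add: exit_rate_fcfs)
      then show "W' u s + (\<Sum>i\<in>UNIV. lam i * W (u @ [i]) s) + (\<Sum>j<length u. \<mu> (u ! j) * W (remove_nth j u) s)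
          \<le> exit_rate ?q u * W u s"
        using lyapunov_drift[of lam \<mu> x s \<beta> u T, OF lam \<mu> \<beta>[OF s(1)]] by (simp add: W_def W'_def)
    qed (simp_all add: t less_imp_le[OF lam] less_imp_le[OF \<mu>] exit_pos W_nonneg W_deriv)
  qed (use T \<sigma> \<eta> in auto)
  have [measurable]: "(\<lambda>\<omega>. W (Z 0 \<omega>) 0) \<in> borel_measurable M"
    by (rule measurable_compose[OF Z_measurable borel_measurable_count_space])
  have [measurable]: "Measurable.pred M (exceeds W T (\<sigma>\<^sup>2) k)" for k
    by (rule exceeds_measurable) measurable
  have "prob X \<le> prob ({\<omega>\<in>space M. \<eta> < W (Z 0 \<omega>) 0} \<union>
      {\<omega>\<in>space M. W (Z 0 \<omega>) 0 \<le> \<eta> \<and> (\<exists>k. exceeds W T (\<sigma>\<^sup>2) k \<omega>)})"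
    (is "_ \<le> prob (?A \<union> ?B)")
  proof (rule finite_measure_mono_AE)
    show "AE \<omega> in M. \<omega> \<in> X \<longrightarrow> \<omega> \<in> ?A \<union> ?B"
      using AE_jump_prob_nonzero AE_space
    proof eventually_elim
      fix \<omega> assume jumps: "\<forall>k. jump_prob ?q (Z k \<omega>) (Z (Suc k) \<omega>) \<noteq> 0" and \<omega>: "\<omega> \<in> space M"
      show "\<omega> \<in> X \<longrightarrow> \<omega> \<in> ?A \<union> ?B"
      proof (intro impI, rule ccontr)
        assume "\<omega> \<in> X" and "\<omega> \<notin> ?A \<union> ?B"
        then have start: "W (Z 0 \<omega>) 0 \<le> \<eta>" and calm: "\<And>k. \<not> exceeds W T (\<sigma>\<^sup>2) k \<omega>"
          using \<omega> by auto
        obtain t i where t: "0 \<le> t" "t \<le> T"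
          and far: "\<sigma> + 1 / lam i \<le> \<bar>real (count_list (U t \<omega>) i) / lam i - x i t\<bar>"
          using X[OF \<open>\<omega> \<in> X\<close>] by auto
        obtain k where k: "jump_time k \<omega> \<le> t" "t < jump_time (Suc k) \<omega>" "U t \<omega> = Z k \<omega>"
          using path[OF \<omega> t(1)] by blast
        define c where "c = real (count_list (Z k \<omega>) i) / lam i"
        have kT: "jump_time k \<omega> \<le> T" using k t by simp
        \<comment> \<open>The sojourn starts at time 0, where \<open>start\<close> applies, or at
          the end of the preceding step, which did not exceed.\<close>
        have "W (Z k \<omega>) (jump_time k \<omega>) < \<sigma>\<^sup>2"
        proof (cases k)
          case 0
          then show ?thesis using start \<eta> by simp
        next
          case (Suc j)
          then have "jump_time j \<omega> \<le> T" using kT jump_time_mono[OF \<omega>, of j k] by simp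
          then show ?thesis using calm[of j] kT Suc by (simp add: exceeds_def not_le)
        qed
        then have left: "\<bar>c - x i (jump_time k \<omega>)\<bar> < \<sigma>"
          using dev kT by (simp add: c_def)
        \<comment> \<open>The right end point \<open>r\<close> is the next jump time, at the cost of
          one job, or \<open>T\<close> if that comes first, where the state is still
          \<open>Z k \<omega>\<close>.\<close>
        have right: "\<exists>r\<ge>t. \<bar>c - x i r\<bar> < \<sigma> + 1 / lam i"
        proof (cases "jump_time (Suc k) \<omega> \<le> T")
          case True
          let ?c' = "real (count_list (Z (Suc k) \<omega>) i) / lam i"
          have "\<bar>?c' - x i (jump_time (Suc k) \<omega>)\<bar> < \<sigma>"
            using dev True calm[of k] kT by (simp add: exceeds_def not_le)
          moreover have "\<bar>?c' - c\<bar> \<le> 1 / lam i"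
          proof -
            have "\<bar>?c' - c\<bar> = \<bar>real (count_list (Z (Suc k) \<omega>) i) - real (count_list (Z k \<omega>) i)\<bar> / lam i"
              using lam[of i] by (simp add: c_def diff_divide_distrib[symmetric])
            then show ?thesis
              using fcfs_jump_count_diff[OF jumps[rule_format], of k i] lam[of i]
              by (simp add: divide_right_mono)
          qed
          ultimately have "\<bar>c - x i (jump_time (Suc k) \<omega>)\<bar> < \<sigma> + 1 / lam i" by argo
          then show ?thesis using k by (intro exI[of _ "jump_time (Suc k) \<omega>"]) auto
        next
          case False
          then have "\<bar>c - x i T\<bar> < \<sigma>"
            using dev calm[of k] kT by (simp add: exceeds_def not_le c_def)
          moreover have "0 < 1 / lam i" using lam[of i] by simp
          ultimately have "\<bar>c - x i T\<bar> < \<sigma> + 1 / lam i" by linarith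
          then show ?thesis using t by blast
        qed
        then obtain r where r: "t \<le> r" "\<bar>c - x i r\<bar> < \<sigma> + 1 / lam i" by blast
        have "\<bar>c - x i t\<bar> \<le> max \<bar>c - x i (jump_time k \<omega>)\<bar> \<bar>c - x i r\<bar>"
          unfolding x_def by (rule abs_diff_fluid_le[OF \<mu> k(1) r(1)])
        also have "\<dots> < \<sigma> + 1 / lam i"
        proof -
          have "0 < 1 / lam i" using lam[of i] by simp
          then have "\<bar>c - x i (jump_time k \<omega>)\<bar> < \<sigma> + 1 / lam i" using left by linarith
          then show ?thesis using r(2) by simp
        qed
        finally show False using far k(3) by (simp add: c_def)
      qed
    qed
    show "?A \<union> ?B \<in> events" by measurable
  qed
  moreover have "prob (?A \<union> ?B) \<le> prob ?A + prob ?B"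
    by (rule measure_Un_le) measurable
  moreover have "?A = {\<omega>\<in>space M. \<eta> < lyapunov lam x \<beta> T (U 0 \<omega>) 0}"
    using path_0 by (auto simp: W_def)
  ultimately show ?thesis using maximal by (simp add: W_def)
qed

theorem theorem4p3:
  fixes \<mu> :: "'k::finite \<Rightarrow> real"
    and \<rho> :: "'k \<Rightarrow> real"
    and \<Lambda> :: "nat \<Rightarrow> real"
    and p :: "nat \<Rightarrow> 'k \<Rightarrow> real"
    and lam :: "nat \<Rightarrow> 'k \<Rightarrow> real"
    and m :: "nat \<Rightarrow> 'k \<Rightarrow> nat"
    and M :: "nat \<Rightarrow> 'w measure"
    and U :: "nat \<Rightarrow> real \<Rightarrow> 'w \<Rightarrow> 'k list"
    and y :: "real \<Rightarrow> 'k \<Rightarrow> real"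
    and T :: real
  assumes mu_pos: "\<And>i. 0 < \<mu> i"
    and total_rate_pos: "\<And>n. 1 \<le> n \<Longrightarrow> 0 < \<Lambda> n"
    and class_prob_nonneg: "\<And>n i. 1 \<le> n \<Longrightarrow> 0 \<le> p n i"
    and class_prob_sum: "\<And>n. 1 \<le> n \<Longrightarrow> (\<Sum>i\<in>UNIV. p n i) = 1"
    and class_rate: "\<And>n i. 1 \<le> n \<Longrightarrow> lam n i = \<Lambda> n * p n i"
    and need: "\<And>n i. 1 \<le> n \<Longrightarrow> 1 \<le> m n i \<and> m n i \<le> n"
    and chain: "\<And>n. 1 \<le> n \<Longrightarrow> is_ctmc (M n) (fcfs_rate n (lam n) (m n) \<mu>) (U n)"
    and load: "\<And>n i. 1 \<le> n \<Longrightarrow> lam n i * real (m n i) / (real n * \<mu> i) = \<rho> i"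
    and load_pos: "\<And>i. 0 < \<rho> i"
    and load_less_1: "(\<Sum>i\<in>UNIV. \<rho> i) < 1"
    and initial: "\<And>i. tendsto_in_prob M (\<lambda>n \<omega>. 1 / lam n i * real (num_jobs (U n) i 0 \<omega>)) (y 0 i)"
    and initial_bounds: "\<And>i. 0 \<le> y 0 i \<and> y 0 i < 1 / ((\<Sum>j\<in>UNIV. \<rho> j) * \<mu> i)"
    and ode: "\<And>i t. 0 \<le> t \<Longrightarrow>
      ((\<lambda>s. y s i) has_real_derivative 1 - min (\<mu> i * y t i) (1 / \<rho> i)) (at t within {0..})"
    and max_need: "(\<lambda>n. real (Max (range (m n)))) \<in> o(\<lambda>n. real n)"
    and T_pos: "0 < T"
  shows "tendsto_in_prob M
    (\<lambda>n \<omega>. SUP t\<in>{0..T}. \<Sum>i\<in>UNIV. \<bar>1 / lam n i * real (num_jobs (U n) i t \<omega>) - y t i\<bar>) 0"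
proof -
  define \<rho>s where "\<rho>s = (\<Sum>j\<in>UNIV. \<rho> j)"
  define K where "K = real CARD('k)"
  define a where "a = y 0"
  define x where "x i = fluid (\<mu> i) (a i)" for i
  define c where "c i = max (\<mu> i * a i) 1" for i
  \<comment> \<open>Along the fluid solution class \<open>i\<close> occupies the fraction
    \<open>\<rho> i * (\<mu> i * x i t)\<close> of the servers, which is at most
    \<open>\<rho> i * c i\<close>; so a fraction of at least \<open>\<delta>\<close> is idle. It is
    positive because \<open>c i < 1 / \<rho>s\<close> and the \<open>\<rho> i\<close> sum to
    \<open>\<rho>s\<close>.\<close>
  define \<delta> where "\<delta> = 1 - (\<Sum>i\<in>UNIV. \<rho> i * c i)"
  define \<beta> where "\<beta> n i = (1 + c i) / lam n i + \<mu> i / (lam n i)\<^sup>2" for n i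
  define D where "D n \<omega> = (SUP t\<in>{0..T}. \<Sum>i\<in>UNIV. \<bar>1 / lam n i * real (num_jobs (U n) i t \<omega>) - y t i\<bar>)" for n \<omega>
  have K: "0 < K" by (simp add: K_def)
  have \<rho>s: "0 < \<rho>s" "\<rho>s < 1" using load_pos load_less_1 by (auto simp: \<rho>s_def intro!: sum_pos)
  have c_less: "c i < 1 / \<rho>s" and c_ge: "1 \<le> c i" for i
    using initial_bounds[of i] mu_pos[of i] \<rho>s by (auto simp: c_def a_def \<rho>s_def[symmetric] field_simps)
  have "(\<Sum>i\<in>UNIV. \<rho> i * c i) < (\<Sum>i\<in>UNIV. \<rho> i * (1 / \<rho>s))"
    using load_pos c_less by (intro sum_strict_mono mult_strict_left_mono) auto
  also have "\<dots> = 1"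
    using \<rho>s by (simp add: sum_divide_distrib[symmetric] \<rho>s_def[symmetric])
  finally have \<delta>: "0 < \<delta>" by (simp add: \<delta>_def)
  have \<mu>x_le: "\<mu> i * x i t \<le> c i" if "0 \<le> t" for i t
    using fluid_le[OF mu_pos that] by (simp add: x_def c_def)
  have y_eq: "y t i = x i t" if "0 \<le> t" for t i
  proof -
    \<comment> \<open>The cap \<open>1 / \<rho> i\<close> is at least \<open>1 / \<rho>s\<close>,
      hence above \<open>c i\<close>, the maximum of \<open>\<mu> i * y 0 i\<close> and 1; these are
      the two conditions of \<open>ode_eq_fluid\<close>.\<close>
    have "\<rho> i \<le> \<rho>s" unfolding \<rho>s_def by (intro member_le_sum) (auto intro: less_imp_le load_pos)
    then have "1 / \<rho>s \<le> 1 / \<rho> i" using load_pos[of i] by (simp add: frac_le)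
    then show ?thesis
      using c_less[of i] c_ge[of i] unfolding x_def a_def
      by (intro ode_eq_fluid[OF mu_pos ode _ _ that]) (auto simp: c_def a_def)
  qed
  have lam_pos: "0 < lam n i" and lam_eq: "1 / lam n i = 1 / (\<rho> i * \<mu> i) * (real (m n i) / real n)"
    and lam_need: "lam n i * real (m n i) = real n * (\<rho> i * \<mu> i)" if n: "1 \<le> n" for n i
  proof -
    show eq: "lam n i * real (m n i) = real n * (\<rho> i * \<mu> i)"
      using load[OF n, of i] n mu_pos[of i] by (simp add: field_simps)
    have m: "0 < real (m n i)" using need[OF n, of i] by simp
    have "0 < real n * (\<rho> i * \<mu> i)" using n load_pos[of i] mu_pos[of i] by simp
    with eq m show pos: "0 < lam n i" by (metis zero_less_mult_pos2)
    show "1 / lam n i = 1 / (\<rho> i * \<mu> i) * (real (m n i) / real n)"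
      using eq pos n load_pos[of i] mu_pos[of i] by (simp add: field_simps)
  qed
  have need_ratio: "(\<lambda>n. real (m n i) / real n) \<longlonglongrightarrow> 0" for i
  proof (rule tendsto_sandwich[OF _ _ tendsto_const])
    show "(\<lambda>n. real (Max (range (m n))) / real n) \<longlonglongrightarrow> 0"
      using max_need by (rule smalloD_tendsto)
    show "\<forall>\<^sub>F n in sequentially. real (m n i) / real n \<le> real (Max (range (m n))) / real n"
      by (intro always_eventually allI divide_right_mono) auto
  qed auto
  have inv_lam: "(\<lambda>n. 1 / lam n i) \<longlonglongrightarrow> 0" for i
  proof -
    have "(\<lambda>n. 1 / (\<rho> i * \<mu> i) * (real (m n i) / real n)) \<longlonglongrightarrow> 0"
      using tendsto_mult_left[OF need_ratio, of "1 / (\<rho> i * \<mu> i)"] by simp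
    moreover have "\<forall>\<^sub>F n in sequentially. 1 / (\<rho> i * \<mu> i) * (real (m n i) / real n) = 1 / lam n i"
      using eventually_ge_at_top[of 1] by eventually_elim (rule lam_eq[symmetric])
    ultimately show ?thesis by (rule Lim_transform_eventually)
  qed
  have \<beta>_lim: "(\<lambda>n. \<Sum>i\<in>UNIV. \<beta> n i * T) \<longlonglongrightarrow> 0"
  proof (rule tendsto_null_sum)
    fix i
    have "(\<lambda>n. ((1 + c i) * (1 / lam n i) + \<mu> i * (1 / lam n i)\<^sup>2) * T) \<longlonglongrightarrow> ((1 + c i) * 0 + \<mu> i * 0\<^sup>2) * T"
      by (intro tendsto_intros inv_lam)
    then show "(\<lambda>n. \<beta> n i * T) \<longlonglongrightarrow> 0" by (simp add: \<beta>_def power_divide)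
  qed
  have D_eq: "D n \<omega> = (SUP t\<in>{0..T}. \<Sum>i\<in>UNIV. \<bar>real (count_list (U n t \<omega>) i) / lam n i - x i t\<bar>)" for n \<omega>
    unfolding D_def num_jobs_def using y_eq by (intro SUP_cong) auto
  have x_cont: "continuous_on UNIV (x i)" for i
    unfolding x_def by (rule DERIV_continuous_on) (rule fluid_has_derivative[OF mu_pos])
  have D_meas: "D n \<in> borel_measurable (M n)"
    and D_bdd: "\<omega> \<in> space (M n) \<Longrightarrow>
      bdd_above ((\<lambda>t. \<Sum>i\<in>UNIV. \<bar>real (count_list (U n t \<omega>) i) / lam n i - x i t\<bar>) ` {0..T})"
    if n: "1 \<le> n" for n \<omega>
  proof -
    have exit_pos: "0 < exit_rate (fcfs_rate n (lam n) (m n) \<mu>) u" for u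
      unfolding exit_rate_fcfs
      by (intro add_pos_nonneg sum_pos sum_nonneg lam_pos n less_imp_le[OF mu_pos]) auto
    obtain Z S where "jump_path (M n) (fcfs_rate n (lam n) (m n) \<mu>) Z S (U n)"
      by (rule is_ctmc_jump_path[OF chain[OF n]
          fcfs_rate_nonneg[OF less_imp_le[OF lam_pos[OF n]] less_imp_le[OF mu_pos]] exit_pos])
    then interpret jump_path "M n" "fcfs_rate n (lam n) (m n) \<mu>" Z S "U n" .
    have g: "continuous_on UNIV (\<lambda>t. \<Sum>i\<in>UNIV. \<bar>real (count_list u i) / lam n i - x i t\<bar>)" for u
      by (intro continuous_intros x_cont)
    show "D n \<in> borel_measurable (M n)"
      unfolding D_eq[abs_def]
      using Sup_path_measurable[where g = "\<lambda>u t. \<Sum>i\<in>UNIV. \<bar>real (count_list u i) / lam n i - x i t\<bar>" and T = T, OF g] T_pos by simp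
    show "bdd_above ((\<lambda>t. \<Sum>i\<in>UNIV. \<bar>real (count_list (U n t \<omega>) i) / lam n i - x i t\<bar>) ` {0..T})"
      if "\<omega> \<in> space (M n)"
      using bdd_above_path[where g = "\<lambda>u t. \<Sum>i\<in>UNIV. \<bar>real (count_list u i) / lam n i - x i t\<bar>" and T = T, OF g _ that] T_pos by simp
  qed
  have "(\<lambda>n. measure (M n) {\<omega>\<in>space (M n). \<bar>D n \<omega> - 0\<bar> > \<epsilon>}) \<longlonglongrightarrow> 0" if \<epsilon>: "0 < \<epsilon>" for \<epsilon>
  proof (rule tendstoI)
    fix e :: real assume e: "0 < e"
    define R where "R = (\<Sum>i\<in>UNIV. \<rho> i * \<mu> i)"
    \<comment> \<open>The first bound leaves \<open>\<epsilon> / (2 * K)\<close> per class for the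
      extra \<open>1 / lam n i\<close>. The second gives \<open>\<sigma> * R \<le> \<delta>\<close>:
      a deviation of \<open>\<sigma>\<close> in every class uses up at most the idle
      fraction.\<close>
    define \<sigma> where "\<sigma> = min (\<epsilon> / (2 * K)) (\<delta> / R)"
    \<comment> \<open>The final estimate is below \<open>\<tau> + 2 * \<tau>\<close>, which is less
      than \<open>e\<close>; the cap \<open>1 / 4\<close> ensures
      \<open>\<eta> n < \<sigma>\<^sup>2\<close>.\<close>
    define \<tau> where "\<tau> = min e 1 / 4"
    \<comment> \<open>Chosen so that initial deviations of at most \<open>\<kappa>\<close> in all
      \<open>K\<close> classes have squares summing to at most
      \<open>\<tau> * \<sigma>\<^sup>2\<close>, which keeps the initial Lyapunov value at or below
      \<open>\<eta> n\<close>.\<close>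
    define \<kappa> where "\<kappa> = sqrt (\<tau> * \<sigma>\<^sup>2 / K)"
    define \<eta> where "\<eta> n = \<tau> * \<sigma>\<^sup>2 + (\<Sum>i\<in>UNIV. \<beta> n i * T)" for n
    define P where "P n i = measure (M n) {\<omega>\<in>space (M n). \<bar>1 / lam n i * real (num_jobs (U n) i 0 \<omega>) - y 0 i\<bar> > \<kappa>}" for n i
    have R: "0 < R" unfolding R_def by (intro sum_pos mult_pos_pos load_pos mu_pos) auto
    have \<sigma>: "0 < \<sigma>" using \<epsilon> K \<delta> R by (simp add: \<sigma>_def)
    have \<tau>: "0 < \<tau>" "\<tau> \<le> 1 / 4" "\<tau> \<le> e / 4" using e by (auto simp: \<tau>_def)
    have \<kappa>: "0 < \<kappa>" "K * \<kappa>\<^sup>2 = \<tau> * \<sigma>\<^sup>2" using \<tau> \<sigma> K by (auto simp: \<kappa>_def)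
    have "(\<lambda>n. \<Sum>i\<in>UNIV. P n i) \<longlonglongrightarrow> 0"
      using initial \<kappa>(1) unfolding P_def tendsto_in_prob_def by (intro tendsto_null_sum) blast
    then have "\<forall>\<^sub>F n in sequentially. (\<Sum>i\<in>UNIV. P n i) < \<tau>"
      using \<tau>(1) by (rule order_tendstoD(2))
    moreover have "\<forall>\<^sub>F n in sequentially. (\<Sum>i\<in>UNIV. \<beta> n i * T) < \<tau> * \<sigma>\<^sup>2"
      using \<beta>_lim \<tau>(1) \<sigma> by (intro order_tendstoD(2)) auto
    moreover have "\<forall>\<^sub>F n in sequentially. \<forall>i\<in>UNIV. 1 / lam n i < \<epsilon> / (2 * K)"
      using inv_lam \<epsilon> K by (intro eventually_ball_finite ballI order_tendstoD(2)) auto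
    ultimately show "\<forall>\<^sub>F n in sequentially.
        dist (measure (M n) {\<omega>\<in>space (M n). \<bar>D n \<omega> - 0\<bar> > \<epsilon>}) 0 < e"
      using eventually_ge_at_top[of 1]
    proof eventually_elim
      fix n :: nat
      assume P: "(\<Sum>i\<in>UNIV. P n i) < \<tau>" and \<beta>_small: "(\<Sum>i\<in>UNIV. \<beta> n i * T) < \<tau> * \<sigma>\<^sup>2"
        and lam_large: "\<forall>i\<in>UNIV. 1 / lam n i < \<epsilon> / (2 * K)" and n: "1 \<le> n"
      let ?X = "{\<omega>\<in>space (M n). \<bar>D n \<omega> - 0\<bar> > \<epsilon>}"
      let ?Y = "{\<omega>\<in>space (M n). \<eta> n < lyapunov (lam n) x (\<beta> n) T (U n 0 \<omega>) 0}"
      let ?E = "\<lambda>i. {\<omega>\<in>space (M n). \<bar>1 / lam n i * real (num_jobs (U n) i 0 \<omega>) - y 0 i\<bar> > \<kappa>}"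
      interpret prob_space "M n" using chain[OF n] by (simp add: is_ctmc_def)
      note lam_pos = lam_pos[OF n]
      have E_sets: "?E i \<in> events" for i
      proof -
        have [measurable]: "(\<lambda>\<omega>. 1 / lam n i * real (num_jobs (U n) i 0 \<omega>)) \<in> borel_measurable (M n)"
          using initial[of i] n unfolding tendsto_in_prob_def by blast
        show ?thesis by measurable
      qed
      have \<beta>_nonneg: "0 \<le> \<beta> n i" for i
        using lam_pos[of i] mu_pos[of i] c_ge[of i] by (simp add: \<beta>_def)
      have \<eta>: "0 \<le> \<eta> n" "\<eta> n < 2 * \<tau> * \<sigma>\<^sup>2"
        using \<beta>_small \<tau> \<sigma> T_pos \<beta>_nonneg by (auto simp: \<eta>_def intro!: add_nonneg_nonneg sum_nonneg)
      moreover have "2 * \<tau> * \<sigma>\<^sup>2 \<le> 1 * \<sigma>\<^sup>2" using \<tau> by (intro mult_right_mono) auto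
      ultimately have \<eta>_less: "\<eta> n < \<sigma>\<^sup>2" by simp
      have "measure (M n) ?X \<le> measure (M n) ?Y + \<eta> n / \<sigma>\<^sup>2"
      proof (rule fcfs_deviation_bound[where \<mu> = \<mu> and a = a, folded x_def, OF chain[OF n] lam_pos mu_pos])
        fix u t assume t: "0 \<le> t" "t \<le> T"
          and close: "\<And>i. \<bar>real (count_list u i) / lam n i - x i t\<bar> < \<sigma>"
        \<comment> \<open>The fixed load \<open>lam n i * m n i = n * \<rho> i * \<mu> i\<close>
          expresses the total need by the scaled counts, uniformly in \<open>n\<close>.\<close>
        have "real (\<Sum>i\<in>UNIV. count_list u i * m n i) = (\<Sum>i\<in>UNIV. real n * (\<rho> i * \<mu> i * (real (count_list u i) / lam n i)))"
          unfolding of_nat_sum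
        proof (rule sum.cong[OF refl])
          fix i
          have "real (count_list u i * m n i) = (lam n i * real (m n i)) * (real (count_list u i) / lam n i)"
            using lam_pos[of i] by simp
          then show "real (count_list u i * m n i) = real n * (\<rho> i * \<mu> i * (real (count_list u i) / lam n i))"
            unfolding lam_need[OF n] by simp
        qed
        also have "\<dots> \<le> (\<Sum>i\<in>UNIV. real n * (\<rho> i * c i + \<sigma> * (\<rho> i * \<mu> i)))"
        proof (intro sum_mono mult_left_mono)
          fix i
          have "\<rho> i * (\<mu> i * (real (count_list u i) / lam n i)) \<le> \<rho> i * (\<mu> i * (x i t + \<sigma>))"
            using close[of i] load_pos[of i] mu_pos[of i] by (intro mult_left_mono) auto
          also have "\<dots> = \<rho> i * (\<mu> i * x i t) + \<sigma> * (\<rho> i * \<mu> i)" by (simp add: algebra_simps)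
          also have "\<dots> \<le> \<rho> i * c i + \<sigma> * (\<rho> i * \<mu> i)"
            using \<mu>x_le[OF t(1), of i] load_pos[of i] by simp
          finally show "\<rho> i * \<mu> i * (real (count_list u i) / lam n i) \<le> \<rho> i * c i + \<sigma> * (\<rho> i * \<mu> i)"
            by (simp only: mult.assoc)
        qed simp
        also have "\<dots> = real n * (1 - \<delta> + \<sigma> * R)"
          by (simp add: sum_distrib_left[symmetric] sum.distrib R_def \<delta>_def)
        also have "\<dots> \<le> real n * 1"
        proof (intro mult_left_mono)
          have "\<sigma> * R \<le> \<delta> / R * R" using R by (intro mult_right_mono) (auto simp: \<sigma>_def)
          then show "1 - \<delta> + \<sigma> * R \<le> 1" using R by simp
        qed simp
        finally show "(\<Sum>i\<in>UNIV. count_list u i * m n i) \<le> n" by (simp only: mult_1_right of_nat_le_iff)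
      next
        fix i and t :: real assume "0 \<le> t"
        then show "(1 + \<mu> i * x i t) / lam n i + \<mu> i / (lam n i)\<^sup>2 \<le> \<beta> n i"
          using \<mu>x_le[of t i] lam_pos[of i] by (simp add: \<beta>_def divide_right_mono)
      next
        fix \<omega> assume \<omega>: "\<omega> \<in> ?X"
        show "\<exists>t\<in>{0..T}. \<exists>i. \<sigma> + 1 / lam n i \<le> \<bar>real (count_list (U n t \<omega>) i) / lam n i - x i t\<bar>"
        proof (rule ccontr)
          assume "\<not> ?thesis"
          then have less: "\<bar>real (count_list (U n t \<omega>) i) / lam n i - x i t\<bar> < \<sigma> + 1 / lam n i"
            if "t \<in> {0..T}" for t i
            using that by (force simp: not_le)
          have le: "(\<Sum>i\<in>UNIV. \<bar>real (count_list (U n t \<omega>) i) / lam n i - x i t\<bar>) \<le> \<epsilon>"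
            if t: "t \<in> {0..T}" for t
          proof -
            have "(\<Sum>i\<in>UNIV. \<bar>real (count_list (U n t \<omega>) i) / lam n i - x i t\<bar>) \<le> (\<Sum>i\<in>(UNIV::'k set). \<epsilon> / K)"
            proof (rule sum_mono)
              fix i
              have "\<sigma> \<le> \<epsilon> / (2 * K)" by (simp add: \<sigma>_def)
              moreover have "1 / lam n i < \<epsilon> / (2 * K)" using lam_large by blast
              moreover have "\<epsilon> / (2 * K) + \<epsilon> / (2 * K) = \<epsilon> / K" by simp
              ultimately show "\<bar>real (count_list (U n t \<omega>) i) / lam n i - x i t\<bar> \<le> \<epsilon> / K"
                using less[OF t, of i] by linarith
            qed
            also have "\<dots> = \<epsilon>" by (simp add: K_def)
            finally show ?thesis .
          qed
          have "D n \<omega> \<le> \<epsilon>"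
            unfolding D_eq by (rule cSUP_least) (use T_pos le in auto)
          \<comment> \<open>The event is about the absolute value of \<open>D n \<omega>\<close>, so
            the sign of the supremum matters; it needs the boundedness of the path
            functional.\<close>
          moreover have "0 \<le> D n \<omega>"
          proof -
            have "0 \<le> (\<Sum>i\<in>UNIV. \<bar>real (count_list (U n 0 \<omega>) i) / lam n i - x i 0\<bar>)"
              by (intro sum_nonneg) simp
            also have "\<dots> \<le> D n \<omega>"
              unfolding D_eq by (rule cSUP_upper[OF _ D_bdd[OF n]]) (use \<omega> T_pos in auto)
            finally show ?thesis .
          qed
          ultimately show False using \<omega> by simp
        qed
      qed (use \<beta>_nonneg T_pos \<sigma> \<eta> \<eta>_less in auto)
      also have "measure (M n) ?Y \<le> measure (M n) (\<Union>i\<in>UNIV. ?E i)"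
      proof (rule finite_measure_mono)
        \<comment> \<open>At time 0 the linear term of the Lyapunov function equals the sum of
          \<open>\<beta> n i * T\<close>, which is exactly the second part of
          \<open>\<eta> n\<close>; exceeding \<open>\<eta> n\<close> thus forces some class to
          deviate by more than \<open>\<kappa>\<close>.\<close>
        show "?Y \<subseteq> (\<Union>i\<in>UNIV. ?E i)"
        proof (rule subsetI, rule ccontr)
          fix \<omega> assume \<omega>: "\<omega> \<in> ?Y" and "\<omega> \<notin> (\<Union>i\<in>UNIV. ?E i)"
          then have "\<bar>real (count_list (U n 0 \<omega>) i) / lam n i - x i 0\<bar> \<le> \<kappa>" for i
            by (auto simp: num_jobs_def not_less y_eq)
          then have "(real (count_list (U n 0 \<omega>) i) / lam n i - x i 0)\<^sup>2 \<le> \<kappa>\<^sup>2" for i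
            using abs_le_square_iff[of _ \<kappa>] \<kappa>(1) by (metis abs_of_pos)
          then have "lyapunov (lam n) x (\<beta> n) T (U n 0 \<omega>) 0 \<le> (\<Sum>i\<in>(UNIV :: 'k set). \<kappa>\<^sup>2 + \<beta> n i * T)"
            unfolding lyapunov_def by (intro sum_mono) simp
          also have "\<dots> = \<eta> n" using \<kappa>(2) by (simp add: sum.distrib K_def \<eta>_def)
          finally show False using \<omega> by simp
        qed
        show "(\<Union>i\<in>UNIV. ?E i) \<in> events"
          by (intro sets.finite_UN E_sets) simp
      qed
      also have "\<dots> \<le> (\<Sum>i\<in>UNIV. P n i)"
        unfolding P_def
        by (intro measure_UNION_le E_sets) simp
      finally have "measure (M n) ?X \<le> (\<Sum>i\<in>UNIV. P n i) + \<eta> n / \<sigma>\<^sup>2" by simp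
      moreover have "\<eta> n / \<sigma>\<^sup>2 < 2 * \<tau>" using \<eta>(2) \<sigma> by (simp add: divide_less_eq)
      ultimately have "measure (M n) ?X < e" using P \<tau> by simp
      then show "dist (measure (M n) ?X) 0 < e" by simp
    qed
  qed
  with D_meas show ?thesis unfolding tendsto_in_prob_def D_def by blast
qed

end
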